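(* Let $X$ be a finite dimensional real normed linear space which is smooth and strictly convex and let $d=\dim X$. Suppose $G'$ is obtained from a finite simple graph $G=(V,E)$ by a $d$-dimensional $1$-extension. If $G$ is independent in $X$ then $G'$ is independent in $X$. Further, if both $G$ and $G'$ are independent in $X$, then $G$ is rigid in $X$ if and only if $G'$ is rigid in $X$.
   Context: $1$-extension: let $G=(V,E)$ contain distinct vertices $v_1,\dots,v_{d+1}$ and the edge $v_dv_{d+1}\in E$. The graph $G'$ obtained from $G$ by a $d$-dimensional $1$-extension on $v_1,\dots,v_{d+1}$ and the edge $v_dv_{d+1}$ has $V(G')=V\cup\{v_0\}$, with $v_0\notin V$ a new vertex, and $E(G')=(E\setminus\{v_dv_{d+1}\})\cup\{v_0v_1,\dots,v_0v_{d+1}\}$. Let $X$ be a finite dimensional real normed space with dual $X^*$. A linear functional $f:X\to\mathbb{R}$ supports a non-zero point $x_0\in X$ if $f(x_0)=\|x_0\|^2$ and $\sup_{\|x\|\le1}|f(x)|=\|x_0\|$. If exactly one linear functional supports $x_0$ then $x_0$ is called smooth and $\varphi_{x_0}$ denotes this functional. $X$ is smooth if every non-zero point is smooth, and strictly convex if $\|x+y\|<\|x\|+\|y\|$ whenever $x,y$ are non-zero and $x$ is not a scalar multiple of $y$ (equivalently, if the closed unit ball of $X$ is strictly convex). A placement of $G=(V,E)$ in $X$ is a point $p=(p_v)_{v\in V}\in X^V$ with $p_v\neq p_w$ for each $vw\in E$; it is well-positioned if $p_v-p_w$ is smooth for every $vw\in E$. Fix a basis $b_1,\dots,b_d$ of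 $X$. For well-positioned $p$, the rigidity matrix $R(G,p)$ has rows indexed by $E$ and columns indexed by $V\times\{1,\dots,d\}$; for $e=vw$ its $(e,(v,k))$ entry is $\varphi_{p_v-p_w}(b_k)$, its $(e,(w,k))$ entry is $\varphi_{p_w-p_v}(b_k)=-\varphi_{p_v-p_w}(b_k)$, and the remaining entries of row $e$ are $0$. $(G,p)$ is independent if the rows of $R(G,p)$ are linearly independent, and regular if $\operatorname{rank}R(G,p)$ is maximal among all well-positioned placements of $G$ in $X$. Let $\mathcal{O}_p$ be the set of $p'\in X^V$ for which there is an isometry $T:X\to X$ with $p_v=T(p'_v)$ for all $v\in V$; it is a smooth submanifold of $X^V$, and $\mathcal{T}(p)$ denotes its tangent space at $p$. A regular framework $(G,p)$ is rigid in $X$ if $\operatorname{rank}R(G,p)=d|V|-\dim\mathcal{T}(p)$. The graph $G$ is independent (resp. rigid) in $X$ if $(G,p)$ is independent (resp. rigid) for some placement $p$. *)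

theory Defs
  imports "HOL-Analysis.Analysis" "HOL-Library.Function_Algebras"
begin

text \<open>Pointwise vector space structure on functions, so that \<^const>\<open>dim\<close> and
  \<^const>\<open>independent\<close> apply to rows of the rigidity matrix and to subsets of \<open>X\<^sup>V\<close>.\<close>

instantiation "fun" :: (type, real_vector) real_vector
begin

definition scaleR_fun :: "real \<Rightarrow> ('a \<Rightarrow> 'b) \<Rightarrow> 'a \<Rightarrow> 'b" where
  "scaleR_fun c f = (\<lambda>x. c *\<^sub>R f x)"

instance
  by standard (simp_all add: scaleR_fun_def fun_eq_iff scaleR_add_right scaleR_add_left)

end

subsection \<open>Normed spaces\<close>

text \<open>The supremum is meaningful for bounded \<open>f\<close> only; in finite dimension every linear
  functional is bounded.\<close>

definition supports :: "('a::real_normed_vector \<Rightarrow> real) \<Rightarrow> 'a \<Rightarrow> bool" where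
  "supports f x0 \<longleftrightarrow>
     linear f \<and> f x0 = (norm x0)\<^sup>2 \<and> (SUP x\<in>{x. norm x \<le> 1}. \<bar>f x\<bar>) = norm x0"

definition smooth_point :: "'a::real_normed_vector \<Rightarrow> bool" where
  "smooth_point x0 \<longleftrightarrow> x0 \<noteq> 0 \<and> (\<exists>!f. supports f x0)"

definition support_functional :: "'a::real_normed_vector \<Rightarrow> 'a \<Rightarrow> real" where
  "support_functional x0 = (THE f. supports f x0)"

definition smooth_space :: "'a::real_normed_vector itself \<Rightarrow> bool" where
  "smooth_space _ \<longleftrightarrow> (\<forall>x::'a. x \<noteq> 0 \<longrightarrow> smooth_point x)"

definition strictly_convex_space :: "'a::real_normed_vector itself \<Rightarrow> bool" where
  "strictly_convex_space _ \<longleftrightarrow>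
     (\<forall>x y::'a. x \<noteq> 0 \<longrightarrow> y \<noteq> 0 \<longrightarrow> \<not> (\<exists>c::real. x = c *\<^sub>R y) \<longrightarrow> norm (x + y) < norm x + norm y)"

definition finite_dimensional :: "'a::real_normed_vector itself \<Rightarrow> bool" where
  "finite_dimensional _ \<longleftrightarrow> (\<exists>B::'a set. finite B \<and> span B = UNIV)"

text \<open>For a finite dimensional space: \<open>b 1, \<dots>, b d\<close> is a basis, where \<open>d\<close> is the dimension.\<close>

definition basis_family :: "(nat \<Rightarrow> 'a::real_normed_vector) \<Rightarrow> bool" where
  "basis_family b \<longleftrightarrow>
     inj_on b {1..dim (UNIV::'a set)} \<and> independent (b ` {1..dim (UNIV::'a set)}) \<and>
     span (b ` {1..dim (UNIV::'a set)}) = UNIV"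

definition isometry :: "('a::real_normed_vector \<Rightarrow> 'a) \<Rightarrow> bool" where
  "isometry T \<longleftrightarrow> (\<forall>x y. dist (T x) (T y) = dist x y)"

subsection \<open>Graphs\<close>

definition simple_graph :: "'v set \<Rightarrow> 'v set set \<Rightarrow> bool" where
  "simple_graph V E \<longleftrightarrow> finite V \<and> (\<forall>e\<in>E. e \<subseteq> V \<and> card e = 2)"

definition one_extension ::
    "nat \<Rightarrow> 'v set \<Rightarrow> 'v set set \<Rightarrow> 'v set \<Rightarrow> 'v set set \<Rightarrow> bool" where
  "one_extension d V E V' E' \<longleftrightarrow>
     (\<exists>(v :: nat \<Rightarrow> 'v) v0. inj_on v {1..d+1} \<and> v ` {1..d+1} \<subseteq> V \<and> {v d, v (d+1)} \<in> E \<and> v0 \<notin> V \<and>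
        V' = insert v0 V \<and>
        E' = (E - {{v d, v (d+1)}}) \<union> (\<lambda>i. {v0, v i}) ` {1..d+1})"

subsection \<open>Frameworks\<close>

text \<open>\<open>X\<^sup>V\<close>, with families indexed by \<open>V\<close> extended by \<open>0\<close> outside \<open>V\<close>.\<close>

definition configurations :: "'v set \<Rightarrow> ('v \<Rightarrow> 'a::real_normed_vector) set" where
  "configurations V = {p. \<forall>v. v \<notin> V \<longrightarrow> p v = 0}"

definition placement :: "'v set \<Rightarrow> 'v set set \<Rightarrow> ('v \<Rightarrow> 'a::real_normed_vector) \<Rightarrow> bool" where
  "placement V E p \<longleftrightarrow> p \<in> configurations V \<and> (\<forall>v w. {v, w} \<in> E \<longrightarrow> p v \<noteq> p w)"

definition well_positioned :: "'v set \<Rightarrow> 'v set set \<Rightarrow> ('v \<Rightarrow> 'a::real_normed_vector) \<Rightarrow> bool" where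
  "well_positioned V E p \<longleftrightarrow>
     placement V E p \<and> (\<forall>v w. {v, w} \<in> E \<longrightarrow> smooth_point (p v - p w))"

text \<open>\<open>rigidity_matrix b p e\<close> is the row of the edge \<open>e\<close>. Columns are pairs \<open>(v, k)\<close>; all
  entries outside \<open>V \<times> {1..d}\<close> are \<open>0\<close>. The term \<open>THE w. e = {v, w}\<close> is the endpoint of \<open>e\<close>
  other than \<open>v\<close>.\<close>

definition rigidity_matrix ::
    "(nat \<Rightarrow> 'a::real_normed_vector) \<Rightarrow> ('v \<Rightarrow> 'a) \<Rightarrow> 'v set \<Rightarrow> 'v \<times> nat \<Rightarrow> real" where
  "rigidity_matrix b p e = (\<lambda>(v, k).
     if v \<in> e \<and> k \<in> {1..dim (UNIV::'a set)}
     then support_functional (p v - p (THE w. e = {v, w})) (b k)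
     else 0)"

definition rigidity_rank ::
    "(nat \<Rightarrow> 'a::real_normed_vector) \<Rightarrow> 'v set set \<Rightarrow> ('v \<Rightarrow> 'a) \<Rightarrow> nat" where
  "rigidity_rank b E p = dim (rigidity_matrix b p ` E)"

text \<open>Injectivity is needed because linear independence concerns the rows as a family.\<close>

definition independent_framework ::
    "(nat \<Rightarrow> 'a::real_normed_vector) \<Rightarrow> 'v set \<Rightarrow> 'v set set \<Rightarrow> ('v \<Rightarrow> 'a) \<Rightarrow> bool" where
  "independent_framework b V E p \<longleftrightarrow>
     well_positioned V E p \<and> inj_on (rigidity_matrix b p) E \<and> independent (rigidity_matrix b p ` E)"

definition regular_framework ::
    "(nat \<Rightarrow> 'a::real_normed_vector) \<Rightarrow> 'v set \<Rightarrow> 'v set set \<Rightarrow> ('v \<Rightarrow> 'a) \<Rightarrow> bool" where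
  "regular_framework b V E p \<longleftrightarrow>
     well_positioned V E p \<and>
     (\<forall>q. well_positioned V E q \<longrightarrow> rigidity_rank b E q \<le> rigidity_rank b E p)"

definition congruent_configurations ::
    "'v set \<Rightarrow> ('v \<Rightarrow> 'a::real_normed_vector) \<Rightarrow> ('v \<Rightarrow> 'a) set" where
  "congruent_configurations V p =
     {p' \<in> configurations V. \<exists>T. isometry T \<and> (\<forall>v\<in>V. p v = T (p' v))}"

text \<open>Infinitely differentiable on \<open>(-r, r)\<close>, componentwise: \<open>D n\<close> is the \<open>n\<close>-th derivative.\<close>

definition smooth_curve :: "real \<Rightarrow> (real \<Rightarrow> 'v \<Rightarrow> 'a::real_normed_vector) \<Rightarrow> bool" where
  "smooth_curve r c \<longleftrightarrow>
     (\<forall>v. \<exists>D :: nat \<Rightarrow> real \<Rightarrow> 'a. D 0 = (\<lambda>t. c t v) \<and>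
        (\<forall>n. \<forall>t\<in>{-r<..<r}. (D n has_vector_derivative D (Suc n) t) (at t)))"

text \<open>Tangent space at \<open>p\<close> of the submanifold \<^term>\<open>congruent_configurations V p\<close> of \<open>X\<^sup>V\<close>:
  the velocities at \<open>p\<close> of smooth curves running inside the submanifold.\<close>

definition tangent_space ::
    "'v set \<Rightarrow> ('v \<Rightarrow> 'a::real_normed_vector) \<Rightarrow> ('v \<Rightarrow> 'a) set" where
  "tangent_space V p =
     {u. \<exists>r>0. \<exists>c. smooth_curve r c \<and> (\<forall>t\<in>{-r<..<r}. c t \<in> congruent_configurations V p) \<and>
        c 0 = p \<and> (\<forall>v. ((\<lambda>t. c t v) has_vector_derivative u v) (at 0))}"

definition rigid_framework ::
    "(nat \<Rightarrow> 'a::real_normed_vector) \<Rightarrow> 'v set \<Rightarrow> 'v set set \<Rightarrow> ('v \<Rightarrow> 'a) \<Rightarrow> bool" where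
  "rigid_framework b V E p \<longleftrightarrow>
     regular_framework b V E p \<and>
     int (rigidity_rank b E p) = int (dim (UNIV::'a set) * card V) - int (dim (tangent_space V p))"

definition independent_graph ::
    "(nat \<Rightarrow> 'a::real_normed_vector) \<Rightarrow> 'v set \<Rightarrow> 'v set set \<Rightarrow> bool" where
  "independent_graph b V E \<longleftrightarrow> (\<exists>p. independent_framework b V E p)"

definition rigid_graph ::
    "(nat \<Rightarrow> 'a::real_normed_vector) \<Rightarrow> 'v set \<Rightarrow> 'v set set \<Rightarrow> bool" where
  "rigid_graph b V E \<longleftrightarrow> (\<exists>p. rigid_framework b V E p)"

end

theory Submission
  imports Defs
begin

text \<open>A framework is independent iff it carries no non-zero stress. Since the duality map
  \<open>x \<mapsto> \<phi>\<^sub>x\<close> of a smooth space is continuous, independence is an open condition on placements, and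
  strict convexity makes the points \<open>x\<close> with \<open>\<phi>\<^sub>x\<close> outside a given proper subspace of the dual
  dense. So an independent placement of \<open>G\<close> can be perturbed until the midpoint of the
  deleted edge is an admissible position for the new vertex.

  For rigidity, let \<open>D\<close> be the dimension of the space of fields \<open>x \<mapsto> Z x + a\<close> with
  \<open>\<phi>\<^sub>y(Z y) = 0\<close> for all \<open>y\<close>. Such a \<open>Z\<close> generates a one-parameter group of isometries because
  \<open>\<phi>\<close> differentiates \<open>\<parallel>\<cdot>\<parallel>\<^sup>2 / 2\<close>. Conversely, every tangent vector of the orbit of any placement is the
  restriction of such a field; a placement that does not affinely span \<open>X\<close> needs a compactness
  argument here, as the isometries moving it are not unique. Hence the tangent space has dimension at
  most \<open>D\<close>, with equality for affinely spanning placements, and an independent graph with at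
  least \<open>d + 1\<close> vertices is rigid iff \<open>|E| + D = d |V|\<close>. A 1-extension adds one vertex and
  \<open>d\<close> edges.\<close>

section \<open>Finite-dimensional real vector spaces\<close>

text \<open>The orbit is given only pointwise: each point of a curve in it comes with some isometry,
  chosen without any regularity in time. So only the positions can be differentiated, not the
  isometries. If the placement is not affinely spanning, an isometry may also move directions that
  the placement does not see, and its displacement divided by the time may diverge. The remedy is to
  take an isometry with the same effect on the placement and nearly least displacement, and to
  divide by that displacement instead of the time. A subsequence converges to a field
  \<open>Z\<close>; near-minimality makes \<open>Z\<close> nonzero somewhere on the placement, and
  comparison at such a vertex gives the factor between the two scales.

  The type \<open>'a\<close> carries just a norm and a finite basis, so all compactness is drawn
  from coordinates by the Bolzano-Weierstrass argument below.

  The inequality |E| + D \<le> d |V| for an independent, affinely spanning placement comes from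
  pairing: each row of the matrix annihilates each tangent vector, so rows and a basis of the
  tangent space are jointly independent among functions on V x {1..d}.\<close>

lemma bolzano_weierstrass_finite_family:
  fixes f :: "nat \<Rightarrow> 'i \<Rightarrow> real"
  assumes "finite I" and "\<And>n i. i \<in> I \<Longrightarrow> \<bar>f n i\<bar> \<le> C"
  obtains l r where "strict_mono (r :: nat \<Rightarrow> nat)" and "\<And>i. i \<in> I \<Longrightarrow> (\<lambda>n. f (r n) i) \<longlonglongrightarrow> l i"
proof -
  have "\<exists>l r. strict_mono (r :: nat \<Rightarrow> nat) \<and> (\<forall>i\<in>I. (\<lambda>n. f (r n) i) \<longlonglongrightarrow> l i)"
    using assms
  proof (induction I rule: finite_induct)
    case empty
    then show ?case by (auto intro!: exI[of _ id] strict_mono_id)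
  next
    case (insert j I)
    then obtain l r where r: "strict_mono (r :: nat \<Rightarrow> nat)" and l: "\<forall>i\<in>I. (\<lambda>n. f (r n) i) \<longlonglongrightarrow> l i"
      by force
    have "bounded (range (\<lambda>n. f (r n) j))"
      unfolding bounded_iff using insert.prems by auto
    then obtain m s where s: "strict_mono (s :: nat \<Rightarrow> nat)" and m: "((\<lambda>n. f (r n) j) \<circ> s) \<longlonglongrightarrow> m"
      using bounded_imp_convergent_subsequence by blast
    have "(\<lambda>n. f ((r \<circ> s) n) i) \<longlonglongrightarrow> (l(j := m)) i" if "i \<in> insert j I" for i
    proof (cases "i = j")
      case True
      then show ?thesis using m by (simp add: o_def)
    next
      case False
      then show ?thesis
        using LIMSEQ_subseq_LIMSEQ[OF _ s, of "\<lambda>n. f (r n) i"] l that by (auto simp: o_def)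
    qed
    then show ?case
      using strict_mono_o[OF r s] by blast
  qed
  then show ?thesis using that by blast
qed

text \<open>Functions vanishing off \<open>I\<close> lie in the span of the indicators of the points
  of \<open>I\<close>. This supplies finiteness in function types that may be
  infinite-dimensional.\<close>

lemma independent_finite_support_card:
  fixes B :: "('i \<Rightarrow> real) set"
  assumes "finite I" and "independent B" and "\<And>f i. f \<in> B \<Longrightarrow> i \<notin> I \<Longrightarrow> f i = 0"
  shows "finite B \<and> card B \<le> card I"
proof -
  define \<delta> :: "'i \<Rightarrow> 'i \<Rightarrow> real" where "\<delta> i = (\<lambda>j. if j = i then 1 else 0)" for i
  have "B \<subseteq> span (\<delta> ` I)"
  proof
    fix f assume f: "f \<in> B"
    have "(\<Sum>i\<in>I. f i *\<^sub>R \<delta> i) x = f x" for x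
    proof -
      have "(\<Sum>i\<in>J. f i *\<^sub>R \<delta> i) x = (\<Sum>i\<in>J. f i * \<delta> i x)" for J :: "'i set"
        by (induction J rule: infinite_finite_induct) (auto simp: scaleR_fun_def)
      then show ?thesis
        using assms(1) assms(3)[OF f, of x] by (auto simp: \<delta>_def sum.delta if_distrib cong: if_cong)
    qed
    then have "f = (\<Sum>i\<in>I. f i *\<^sub>R \<delta> i)" by auto
    also have "\<dots> \<in> span (\<delta> ` I)"
      by (intro span_sum span_scale span_base) auto
    finally show "f \<in> span (\<delta> ` I)" .
  qed
  then have "finite B \<and> card B \<le> card (\<delta> ` I)"
    using assms by (intro independent_span_bound) auto
  then show ?thesis
    using card_image_le[OF assms(1), of \<delta>] by linarith
qed

text \<open>The finite \<open>B\<close> excludes infinite-dimensional \<open>S\<close>, where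
  \<open>dim\<close> takes the default value 0 and the inequality can fail.\<close>

lemma dim_linear_image_le:
  fixes f :: "'c::real_vector \<Rightarrow> 'e::real_vector"
  assumes "linear f" and "finite B" and "S \<subseteq> span B" 
  shows "dim (f ` S) \<le> dim S"
proof -
  obtain A where A: "A \<subseteq> S" "independent A" "S \<subseteq> span A" "card A = dim S"
    using basis_exists by blast
  have "finite A"
    using independent_span_bound[OF assms(2) A(2)] A(1) assms(3) by auto
  have "f ` S \<subseteq> span (f ` A)"
    using A(3) span_linear_image[OF assms(1), of A] by auto
  then have "dim (f ` S) \<le> card (f ` A)"
    using \<open>finite A\<close> by (intro dim_le_card) auto
  then show ?thesis using card_image_le[OF \<open>finite A\<close>, of f] A by linarith
qed

lemma dim_linear_image_eq:
  fixes f :: "'c::real_vector \<Rightarrow> 'e::real_vector"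
  assumes "linear f" and "subspace S" and "\<And>x. x \<in> S \<Longrightarrow> f x = 0 \<Longrightarrow> x = 0"
  shows "dim (f ` S) = dim S"
proof -
  obtain A where A: "A \<subseteq> S" "independent A" "S \<subseteq> span A" "card A = dim S"
    using basis_exists by blast
  have sp: "span A = S"
    using A assms(2) by (simp add: span_subspace)
  have inj: "inj_on f (span A)"
    using assms sp linear_inj_on_iff_eq_0[OF assms(1,2)] by simp
  have "independent (f ` A)"
    by (rule linear_independent_injective_image[OF assms(1) A(2) inj])
  moreover have "span (f ` A) = f ` S"
    using span_linear_image[OF assms(1)] sp by simp
  ultimately have "dim (f ` S) = card (f ` A)"
    by (metis dim_eq_card_independent dim_span)
  also have "\<dots> = card A"
    using inj_on_subset[OF inj] span_superset by (intro card_image) blast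
  finally show ?thesis using A by simp
qed

section \<open>Coordinates in a fixed basis: continuity and compactness\<close>

locale based_space =
  fixes b :: "nat \<Rightarrow> 'a::real_normed_vector" and d :: nat
  assumes basis: "basis_family b" and dim_UNIV: "dim (UNIV :: 'a set) = d"
begin

definition coord :: "nat \<Rightarrow> 'a \<Rightarrow> real" where
  "coord k x = representation (b ` {1..d}) x (b k)"

lemma basis_facts:
  "inj_on b {1..d}" "independent (b ` {1..d})" "span (b ` {1..d}) = UNIV"
  using basis by (auto simp: basis_family_def dim_UNIV)

lemma linear_coord: "linear (coord k)"
  unfolding coord_def using basis_facts
  by (intro linearI) (simp_all add: representation_add representation_scale)

lemma sum_coord: "(\<Sum>k\<in>{1..d}. coord k x *\<^sub>R b k) = x"
proof -
  have "(\<Sum>k\<in>{1..d}. coord k x *\<^sub>R b k) = (\<Sum>y\<in>b ` {1..d}. representation (b ` {1..d}) x y *\<^sub>R y)"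
    using basis_facts(1) by (simp add: sum.reindex coord_def)
  also have "\<dots> = x"
    using basis_facts by (intro sum_representation_eq) auto
  finally show ?thesis .
qed

lemma coord_basis: "k \<in> {1..d} \<Longrightarrow> j \<in> {1..d} \<Longrightarrow> coord k (b j) = (if k = j then 1 else 0)"
proof -
  assume kj: "k \<in> {1..d}" "j \<in> {1..d}"
  have "representation (b ` {1..d}) (b j) = (\<lambda>v. if v = b j then 1 else 0)"
    by (rule representation_basis[OF basis_facts(2) imageI[OF kj(2)]])
  moreover have "b k = b j \<longleftrightarrow> k = j"
    by (rule inj_on_eq_iff[OF basis_facts(1) kj])
  ultimately show ?thesis
    unfolding coord_def by (simp only:)
qed

lemma linear_expand:
  assumes "linear f"
  shows "f x = (\<Sum>k\<in>{1..d}. coord k x *\<^sub>R f (b k))"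
proof -
  have "f x = f (\<Sum>k\<in>{1..d}. coord k x *\<^sub>R b k)" by (simp only: sum_coord)
  then show ?thesis using assms by (simp add: linear_sum linear_scale)
qed

lemma linear_eqI:
  assumes "linear f" "linear g" "\<And>k. k \<in> {1..d} \<Longrightarrow> f (b k) = g (b k)"
  shows "f = g"
proof
  fix x
  show "f x = g x"
    by (subst linear_expand[OF assms(1)], subst linear_expand[OF assms(2)]) (simp add: assms(3))
qed

lemma coord_0: "coord k 0 = 0"
  by (rule linear_0[OF linear_coord])

text \<open>Equivalence of the given norm with the l1 norm of coordinates. If it failed, vectors of
  l1 size 1 would tend to 0 in norm; a coordinatewise limit would represent 0 and still have l1 size
  1. Continuity of every linear map on \<open>'a\<close> rests on this.\<close>

lemma coord_sum_bounded:
  obtains C where "C > 0" and "\<And>x. (\<Sum>k\<in>{1..d}. \<bar>coord k x\<bar>) \<le> C * norm x"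
proof (rule ccontr)
  assume "\<not> thesis"
  then have neg: "\<not> (\<forall>x. (\<Sum>k\<in>{1..d}. \<bar>coord k x\<bar>) \<le> C * norm x)" if "C > 0" for C :: real
    using that \<open>\<And>C. 0 < C \<Longrightarrow> (\<And>x. (\<Sum>k = 1..d. \<bar>coord k x\<bar>) \<le> C * norm x) \<Longrightarrow> thesis\<close> by blast
  have "\<exists>x. (\<Sum>k\<in>{1..d}. \<bar>coord k x\<bar>) = 1 \<and> norm x < 1 / real (Suc n)" for n
  proof -
    obtain y where y: "(\<Sum>k\<in>{1..d}. \<bar>coord k y\<bar>) > real (Suc n) * norm y" (is "?s > _")
      using neg[of "real (Suc n)"] by (force simp: not_le)
    have "?s > 0"
      using y by (meson le_less_trans mult_nonneg_nonneg norm_ge_zero of_nat_0_le_iff)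
    define x where "x = (1 / ?s) *\<^sub>R y"
    have "(\<Sum>k\<in>{1..d}. \<bar>coord k x\<bar>) = 1"
      using \<open>?s > 0\<close> by (simp add: x_def linear_scale[OF linear_coord] abs_mult flip: sum_divide_distrib)
    moreover have "norm x < 1 / real (Suc n)"
      using y \<open>?s > 0\<close> by (simp add: x_def field_simps)
    ultimately show ?thesis by blast
  qed
  then obtain x where x: "\<And>n. (\<Sum>k\<in>{1..d}. \<bar>coord k (x n)\<bar>) = 1" "\<And>n. norm (x n) < 1 / real (Suc n)"
    by metis
  have "\<bar>coord k (x n)\<bar> \<le> 1" if "k \<in> {1..d}" for k n
    using member_le_sum[of k "{1..d}" "\<lambda>k. \<bar>coord k (x n)\<bar>"] that x(1)[of n] by auto
  note bd = this
  obtain l r where r: "strict_mono (r :: nat \<Rightarrow> nat)"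
    and l: "\<And>k. k \<in> {1..d} \<Longrightarrow> (\<lambda>n. coord k (x (r n))) \<longlonglongrightarrow> l k"
    by (rule bolzano_weierstrass_finite_family[of "{1..d}" "\<lambda>n k. coord k (x n)" 1])
      (use bd in auto)
  have "(\<lambda>n. \<Sum>k\<in>{1..d}. coord k (x (r n)) *\<^sub>R b k) \<longlonglongrightarrow> (\<Sum>k\<in>{1..d}. l k *\<^sub>R b k)"
    by (intro tendsto_intros l)
  then have lim: "(\<lambda>n. x (r n)) \<longlonglongrightarrow> (\<Sum>k\<in>{1..d}. l k *\<^sub>R b k)"
    by (simp only: sum_coord)
  have "x \<longlonglongrightarrow> 0"
  proof (rule tendsto_norm_zero_cancel, rule tendsto_sandwich[OF _ _ tendsto_const LIMSEQ_inverse_real_of_nat])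
    show "\<forall>\<^sub>F n in sequentially. norm (x n) \<le> inverse (real (Suc n))"
      using x(2) by (intro always_eventually) (simp add: less_imp_le inverse_eq_divide)
  qed auto
  then have "(\<lambda>n. x (r n)) \<longlonglongrightarrow> 0"
    using r by (simp add: LIMSEQ_subseq_LIMSEQ[of x 0 r, unfolded o_def])
  then have z: "(\<Sum>k\<in>{1..d}. l k *\<^sub>R b k) = 0"
    using lim LIMSEQ_unique by blast
  have "coord j (\<Sum>k\<in>{1..d}. l k *\<^sub>R b k) = l j" if "j \<in> {1..d}" for j
    using that by (simp add: linear_sum[OF linear_coord] linear_scale[OF linear_coord] coord_basis
        if_distrib cong: if_cong)
  then have "l j = 0" if "j \<in> {1..d}" for j
    using that z by (simp add: coord_0)
  moreover have "(\<lambda>n. \<Sum>k\<in>{1..d}. \<bar>coord k (x (r n))\<bar>) \<longlonglongrightarrow> (\<Sum>k\<in>{1..d}. \<bar>l k\<bar>)"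
    by (intro tendsto_intros l)
  ultimately show False
    using x(1) by (simp add: LIMSEQ_const_iff)
qed

lemma coord_bounded:
  obtains C where "C > 0" and "\<And>k x. k \<in> {1..d} \<Longrightarrow> \<bar>coord k x\<bar> \<le> C * norm x"
proof -
  obtain C where "C > 0" and C: "\<And>x. (\<Sum>k\<in>{1..d}. \<bar>coord k x\<bar>) \<le> C * norm x"
    using coord_sum_bounded by blast
  have "\<bar>coord k x\<bar> \<le> C * norm x" if "k \<in> {1..d}" for k x
    using member_le_sum[of k "{1..d}" "\<lambda>k. \<bar>coord k x\<bar>"] that C[of x] by auto
  then show ?thesis using that \<open>C > 0\<close> by blast
qed

text \<open>Stands in for the operator norm, which it dominates up to a constant by
  \<open>opsize_bound\<close>. Being a finite sum over the basis, it is continuous under pointwise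
  limits.\<close>

definition opsize :: "('a \<Rightarrow> 'c::real_normed_vector) \<Rightarrow> real" where
  "opsize f = (\<Sum>k\<in>{1..d}. norm (f (b k)))"

lemma opsize_nonneg: "opsize f \<ge> 0"
  by (simp add: opsize_def sum_nonneg)

lemma opsize_bound:
  "\<exists>C>0. \<forall>(f :: 'a \<Rightarrow> 'c::real_normed_vector) x. linear f \<longrightarrow> norm (f x) \<le> C * opsize f * norm x"
proof -
  obtain C where C: "C > 0" "\<And>k x. k \<in> {1..d} \<Longrightarrow> \<bar>coord k x\<bar> \<le> C * norm x"
    using coord_bounded by blast
  have "norm (f x) \<le> C * opsize f * norm x" if "linear f" for f :: "'a \<Rightarrow> 'c" and x
  proof -
    have "norm (f x) = norm (\<Sum>k\<in>{1..d}. coord k x *\<^sub>R f (b k))"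
      by (subst linear_expand[OF that, of x]) simp
    also have "\<dots> \<le> (\<Sum>k\<in>{1..d}. \<bar>coord k x\<bar> * norm (f (b k)))"
      by (rule order_trans[OF norm_sum]) simp
    also have "\<dots> \<le> (\<Sum>k\<in>{1..d}. (C * norm x) * norm (f (b k)))"
      by (intro sum_mono mult_right_mono C) auto
    also have "\<dots> = C * opsize f * norm x"
      by (simp add: opsize_def sum_distrib_left mult_ac)
    finally show ?thesis .
  qed
  then show ?thesis using C(1) by blast
qed

lemma bounded_linear_if_linear:
  fixes f :: "'a \<Rightarrow> 'c::real_normed_vector"
  assumes "linear f" shows "bounded_linear f"
proof -
  obtain C where C: "\<forall>(f :: 'a \<Rightarrow> 'c) x. linear f \<longrightarrow> norm (f x) \<le> C * opsize f * norm x"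
    using opsize_bound[where 'c='c] by auto
  have "norm (f x) \<le> norm x * (C * opsize f)" for x
    using C[rule_format, OF assms, of x] by (simp add: mult.commute)
  then show ?thesis
    by (rule bounded_linear_intro[OF linear_add[OF assms] linear_scale[OF assms]])
qed

lemma linear_tendsto:
  fixes f :: "'a \<Rightarrow> 'c::real_normed_vector"
  assumes "linear f" "(g \<longlongrightarrow> x) F"
  shows "((\<lambda>t. f (g t)) \<longlongrightarrow> f x) F"
  by (rule bounded_linear.tendsto[OF bounded_linear_if_linear[OF assms(1)] assms(2)])

text \<open>Joint continuity in map and argument: in coordinates the value is a finite sum of
  products, so convergence of the maps on the basis suffices.\<close>

lemma linear_tendsto_pointwise:
  fixes f :: "'t \<Rightarrow> 'a \<Rightarrow> 'c::real_normed_vector"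
  assumes "\<And>n. linear (f n)" "linear g" "\<And>k. k \<in> {1..d} \<Longrightarrow> ((\<lambda>n. f n (b k)) \<longlongrightarrow> g (b k)) F"
    and "(x \<longlongrightarrow> y) F"
  shows "((\<lambda>n. f n (x n)) \<longlongrightarrow> g y) F"
proof -
  have "((\<lambda>n. \<Sum>k\<in>{1..d}. coord k (x n) *\<^sub>R f n (b k)) \<longlongrightarrow> (\<Sum>k\<in>{1..d}. coord k y *\<^sub>R g (b k))) F"
    by (intro tendsto_intros assms linear_tendsto[OF linear_coord])
  moreover have 1: "(\<lambda>n. f n (x n)) = (\<lambda>n. \<Sum>k\<in>{1..d}. coord k (x n) *\<^sub>R f n (b k))"
    by (rule ext, rule linear_expand, rule assms)
  ultimately show ?thesis
    by (subst 1, subst linear_expand[OF assms(2)])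
qed

lemma bounded_sequence_convergent_subsequence:
  fixes x :: "nat \<Rightarrow> 'i \<Rightarrow> 'a"
  assumes "finite I" and "\<And>n i. i \<in> I \<Longrightarrow> norm (x n i) \<le> M"
  obtains l r where "strict_mono (r :: nat \<Rightarrow> nat)" and "\<And>i. i \<in> I \<Longrightarrow> (\<lambda>n. x (r n) i) \<longlonglongrightarrow> l i"
proof -
  obtain C where C: "C > 0" "\<And>k x. k \<in> {1..d} \<Longrightarrow> \<bar>coord k x\<bar> \<le> C * norm x"
    using coord_bounded by blast
  have "\<bar>coord k (x n i)\<bar> \<le> C * M" if "k \<in> {1..d}" "i \<in> I" for k n i
    using C(2)[OF that(1), of "x n i"] assms(2)[OF that(2), of n] C(1) 
    by (meson mult_le_cancel_left_pos order_trans)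
  note bd = this
  obtain l r where r: "strict_mono (r :: nat \<Rightarrow> nat)"
    and l: "\<And>z. z \<in> I \<times> {1..d} \<Longrightarrow> (\<lambda>n. coord (snd z) (x (r n) (fst z))) \<longlonglongrightarrow> l z"
    by (rule bolzano_weierstrass_finite_family[of "I \<times> {1..d}" "\<lambda>n z. coord (snd z) (x n (fst z))" "C * M"])
      (use assms(1) bd in auto)
  have "(\<lambda>n. \<Sum>k\<in>{1..d}. coord k (x (r n) i) *\<^sub>R b k) \<longlonglongrightarrow> (\<Sum>k\<in>{1..d}. l (i, k) *\<^sub>R b k)" if "i \<in> I" for i
    by (intro tendsto_intros) (use that l in force)
  then have "(\<lambda>n. x (r n) i) \<longlonglongrightarrow> (\<Sum>k\<in>{1..d}. l (i, k) *\<^sub>R b k)" if "i \<in> I" for i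
    using that by (simp only: sum_coord)
  then show ?thesis
    by (rule that[OF r])
qed

lemma linear_extension:
  fixes l :: "nat \<Rightarrow> 'c::real_normed_vector"
  obtains f where "linear f" "\<And>k. k \<in> {1..d} \<Longrightarrow> f (b k) = l k"
proof
  let ?f = "\<lambda>x. \<Sum>k\<in>{1..d}. coord k x *\<^sub>R l k"
  show "linear ?f"
    by (intro linearI) (simp_all add: linear_add[OF linear_coord] linear_scale[OF linear_coord]
        scaleR_add_left sum.distrib scaleR_sum_right)
  show "?f (b k) = l k" if "k \<in> {1..d}" for k
  proof -
    have "?f (b k) = (\<Sum>j\<in>{1..d}. if j = k then l j else 0)"
      using that by (intro sum.cong) (auto simp: coord_basis)
    then show ?thesis using that by simp
  qed
qed

lemma operator_convergent_subsequence:
  fixes f :: "nat \<Rightarrow> 'a \<Rightarrow> 'a"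
  assumes lin: "\<And>n. linear (f n)" and bd: "\<And>n k. k \<in> {1..d} \<Longrightarrow> norm (f n (b k)) \<le> M"
  shows "\<exists>r g. strict_mono (r :: nat \<Rightarrow> nat) \<and> linear g \<and> (\<forall>x. (\<lambda>n. f (r n) x) \<longlonglongrightarrow> g x)"
proof -
  obtain l r where r: "strict_mono (r :: nat \<Rightarrow> nat)"
    and l: "\<And>k. k \<in> {1..d} \<Longrightarrow> (\<lambda>n. f (r n) (b k)) \<longlonglongrightarrow> l k"
    by (rule bounded_sequence_convergent_subsequence[of "{1..d}" "\<lambda>n k. f n (b k)" M]) (use bd in auto)
  obtain g where g: "linear g" "\<And>k. k \<in> {1..d} \<Longrightarrow> g (b k) = l k"
    using linear_extension by blast
  have "(\<lambda>n. f (r n) x) \<longlonglongrightarrow> g x" for x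
    by (rule linear_tendsto_pointwise[OF lin g(1) _ tendsto_const]) (simp add: l g(2))
  then show ?thesis using r g(1) by blast
qed

lemma card_basis: "card (b ` {1..d}) = d"
  using card_image[OF basis_facts(1)] by simp

lemma independent_card_le:
  assumes "independent (B :: 'a set)"
  shows "finite B" "card B \<le> d"
  using independent_span_bound[OF _ assms, of "b ` {1..d}"] basis_facts(3) card_basis by auto

lemma span_eq_UNIV_if_card:
  assumes "independent B" "card B = d"
  shows "span B = (UNIV :: 'a set)"
proof (rule ccontr)
  assume "span B \<noteq> UNIV"
  then obtain x where x: "x \<notin> span B" by blast
  then have "independent (insert x B)" using assms(1) by (rule independent_insertI)
  then have "card (insert x B) \<le> d" by (rule independent_card_le(2))
  moreover have "x \<notin> B" using x span_base by blast
  ultimately show False using assms independent_card_le(1)[OF assms(1)] by simp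
qed

lemma linear_inj_imp_bij:
  fixes f :: "'a \<Rightarrow> 'a"
  assumes "linear f" "inj f" shows "bij f"
proof -
  have "independent (f ` b ` {1..d})"
    by (rule linear_independent_injective_image[OF assms(1) basis_facts(2) inj_on_subset[OF assms(2)]]) simp
  moreover have "card (f ` b ` {1..d}) = d"
    using card_image[OF inj_on_subset[OF assms(2) subset_UNIV], of "b ` {1..d}"] card_basis by simp
  ultimately have "span (f ` b ` {1..d}) = UNIV"
    by (rule span_eq_UNIV_if_card)
  then have "f ` UNIV = UNIV"
    using span_linear_image[OF assms(1), of "b ` {1..d}"] basis_facts(3) by simp
  then show ?thesis using assms(2) by (simp add: bij_def)
qed

end

section \<open>Support functionals and isometries\<close>

lemma has_vector_derivative_tendsto_quotient:
  fixes c :: "real \<Rightarrow> 'a::real_normed_vector"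
  assumes "(c has_vector_derivative c') (at t)"
  shows "((\<lambda>s. (c s - c t) /\<^sub>R (s - t)) \<longlongrightarrow> c') (at t)"
proof -
  have lim: "((\<lambda>s. norm (c s - c t - (s - t) *\<^sub>R c') / norm (s - t)) \<longlongrightarrow> 0) (at t)"
    using assms by (simp add: has_vector_derivative_def has_derivative_iff_norm)
  have eq: "norm (c s - c t - (s - t) *\<^sub>R c') / norm (s - t) = norm ((c s - c t) /\<^sub>R (s - t) - c')"
    if "s \<noteq> t" for s
  proof -
    have "(c s - c t) /\<^sub>R (s - t) - c' = (c s - c t - (s - t) *\<^sub>R c') /\<^sub>R (s - t)"
      using that by (simp add: scaleR_diff_right)
    then show ?thesis by (simp add: divide_inverse mult.commute)
  qed
  have "((\<lambda>s. norm ((c s - c t) /\<^sub>R (s - t) - c')) \<longlongrightarrow> 0) (at t)"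
    by (rule Lim_transform_eventually[OF lim], unfold eventually_at_filter)
      (intro always_eventually allI impI, rule eq)
  then show ?thesis
    by (rule LIM_zero_cancel[OF tendsto_norm_zero_cancel])
qed

locale smooth_strictly_convex_space = based_space +
  assumes smooth: "smooth_space TYPE('a)" and strictly_convex: "strictly_convex_space TYPE('a)"
begin

text \<open>Finite dimension bounds the set under the supremum, so the supremum dominates each
  value; conversely the value at \<open>x / norm x\<close> attains the bound. From here on the
  supremum is replaced by a pointwise inequality.\<close>

lemma linear_norm_le_iff_SUP:
  assumes f: "linear (f :: 'a \<Rightarrow> real)" and fx: "f x = (norm x)\<^sup>2"
  shows "(SUP y\<in>{y. norm y \<le> 1}. \<bar>f y\<bar>) = norm x \<longleftrightarrow> (\<forall>y. \<bar>f y\<bar> \<le> norm x * norm y)"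
proof
  assume sup: "(SUP y\<in>{y. norm y \<le> 1}. \<bar>f y\<bar>) = norm x"
  obtain C where C: "\<And>y. norm (f y) \<le> norm y * C"
    using bounded_linear.bounded[OF bounded_linear_if_linear[OF f]] by blast
  have bdd: "bdd_above ((\<lambda>y. \<bar>f y\<bar>) ` {y. norm y \<le> 1})"
  proof (rule bdd_aboveI2)
    fix y :: 'a assume "y \<in> {y. norm y \<le> 1}"
    then have "norm y * \<bar>C\<bar> \<le> 1 * \<bar>C\<bar>"
      by (intro mult_right_mono) auto
    moreover have "norm y * C \<le> norm y * \<bar>C\<bar>"
      by (intro mult_left_mono) auto
    ultimately show "\<bar>f y\<bar> \<le> \<bar>C\<bar>" using C[of y] by simp
  qed
  show "\<forall>y. \<bar>f y\<bar> \<le> norm x * norm y"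
  proof
    fix y
    show "\<bar>f y\<bar> \<le> norm x * norm y"
    proof (cases "y = 0")
      case True
      then show ?thesis using linear_0[OF f] by simp
    next
      case False
      have "\<bar>f ((1 / norm y) *\<^sub>R y)\<bar> \<le> (SUP y\<in>{y. norm y \<le> 1}. \<bar>f y\<bar>)"
        by (rule cSUP_upper[OF _ bdd]) (use False in simp)
      then show ?thesis
        using False sup by (simp add: linear_scale[OF f] abs_mult field_simps)
    qed
  qed
next
  assume le: "\<forall>y. \<bar>f y\<bar> \<le> norm x * norm y"
  show "(SUP y\<in>{y. norm y \<le> 1}. \<bar>f y\<bar>) = norm x"
  proof (rule cSup_eq_maximum)
    show "norm x \<in> (\<lambda>y. \<bar>f y\<bar>) ` {y. norm y \<le> 1}"
    proof (cases "x = 0")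
      case True
      then show ?thesis using linear_0[OF f] by (auto intro!: image_eqI[of _ _ 0])
    next
      case False
      then show ?thesis
        by (intro image_eqI[of _ _ "(1 / norm x) *\<^sub>R x"])
          (auto simp: linear_scale[OF f] fx power2_eq_square abs_mult)
    qed
  next
    fix z assume "z \<in> (\<lambda>y. \<bar>f y\<bar>) ` {y. norm y \<le> 1}"
    then obtain y where y: "norm y \<le> 1" "z = \<bar>f y\<bar>" by auto
    have "norm x * norm y \<le> norm x * 1"
      using y by (intro mult_left_mono) auto
    then show "z \<le> norm x" using y le[rule_format, of y] by simp
  qed
qed

lemma supports_iff:
  "supports f (x :: 'a) \<longleftrightarrow> linear f \<and> f x = (norm x)\<^sup>2 \<and> (\<forall>y. \<bar>f y\<bar> \<le> norm x * norm y)"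
  using linear_norm_le_iff_SUP unfolding supports_def by blast

section \<open>The duality map and its continuity\<close>

abbreviation \<phi> :: "'a \<Rightarrow> 'a \<Rightarrow> real" where "\<phi> \<equiv> support_functional"

text \<open>Also at \<open>0\<close>, where the zero functional is the only one satisfying \<open>supports\<close>.\<close>

lemma ex1_supports: "\<exists>!f. supports f (x :: 'a)"
proof (cases "x = 0")
  case True
  have "supports (\<lambda>_. 0) x" using True by (simp add: supports_iff linear_zero)
  moreover have "f = (\<lambda>_. 0)" if "supports f x" for f
    using that True by (auto simp: supports_iff)
  ultimately show ?thesis by blast
next
  case False
  then show ?thesis using smooth by (simp add: smooth_space_def smooth_point_def)
qed

lemma smooth_point_iff: "smooth_point (x :: 'a) \<longleftrightarrow> x \<noteq> 0"
  using ex1_supports by (simp add: smooth_point_def)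

lemma supports_phi: "supports (\<phi> x) x"
  unfolding support_functional_def by (rule theI'[OF ex1_supports])

lemma linear_phi: "linear (\<phi> x)"
  and phi_self: "\<phi> x x = (norm x)\<^sup>2"
  and phi_le: "\<bar>\<phi> x y\<bar> \<le> norm x * norm y"
  using supports_phi[of x] by (auto simp: supports_iff)

lemma phi_eqI:
  assumes "linear f" "f x = (norm x)\<^sup>2" "\<And>y. \<bar>f y\<bar> \<le> norm x * norm y"
  shows "f = \<phi> x"
  using ex1_supports[of x] supports_phi[of x] assms by (auto simp: supports_iff)

lemma phi_scale: "\<phi> (c *\<^sub>R x) y = c * \<phi> x y"
proof -
  have "(\<lambda>y. c * \<phi> x y) = \<phi> (c *\<^sub>R x)"
  proof (rule phi_eqI)
    show "linear (\<lambda>y. c * \<phi> x y)"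
      using linear_phi by (intro linearI) (simp_all add: linear_add linear_scale algebra_simps)
    show "c * \<phi> x (c *\<^sub>R x) = (norm (c *\<^sub>R x))\<^sup>2"
      by (simp add: linear_scale[OF linear_phi] phi_self power_mult_distrib) (simp add: power2_eq_square)
    show "\<bar>c * \<phi> x y\<bar> \<le> norm (c *\<^sub>R x) * norm y" for y
      using mult_left_mono[OF phi_le[of x y], of "\<bar>c\<bar>"] by (simp add: abs_mult mult.assoc)
  qed
  then show ?thesis by metis
qed

lemma phi_minus: "\<phi> (- x) y = - \<phi> x y"
  using phi_scale[of "-1" x y] by simp

lemma phi_0: "\<phi> 0 y = 0"
  using phi_scale[of 0 0 y] by simp

lemma phi_diff_commute: "\<phi> (x - y) z = - \<phi> (y - x) z"
  using phi_minus[of "y - x" z] by simp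

text \<open>Along a sequence tending to \<open>x\<close> the support functionals are bounded on the
  basis, so a subsequence converges to a linear functional. The defining conditions pass to the
  limit, and uniqueness of the support functional at \<open>x\<close> identifies it.\<close>

lemma isCont_phi: "isCont (\<lambda>x. \<phi> x y) x"
proof (rule ccontr)
  assume "\<not> isCont (\<lambda>x. \<phi> x y) x"
  then obtain e where e: "e > 0"
    and far: "\<And>\<delta>. \<delta> > 0 \<Longrightarrow> \<exists>x'. dist x' x < \<delta> \<and> \<not> dist (\<phi> x' y) (\<phi> x y) < e"
    unfolding continuous_at_eps_delta by blast
  have "\<exists>x'. dist x' x < inverse (real (Suc n)) \<and> \<not> dist (\<phi> x' y) (\<phi> x y) < e" for n
    by (rule far) simp
  then obtain s where s: "\<And>n. dist (s n) x < inverse (real (Suc n))"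
    and s_far: "\<And>n. \<not> dist (\<phi> (s n) y) (\<phi> x y) < e"
    by metis
  have s_lim: "s \<longlonglongrightarrow> x"
  proof (rule metric_LIMSEQ_I)
    fix r :: real assume "r > 0"
    then obtain N where N: "inverse (real (Suc N)) < r" using reals_Archimedean by blast
    have "dist (s n) x < r" if "n \<ge> N" for n
    proof -
      have "inverse (real (Suc n)) \<le> inverse (real (Suc N))" using that by (simp add: field_simps)
      then show ?thesis using s[of n] N by linarith
    qed
    then show "\<exists>N. \<forall>n\<ge>N. dist (s n) x < r" by blast
  qed
  obtain M where M: "\<And>n. norm (s n) \<le> M"
    using convergent_imp_Bseq[OF convergentI[OF s_lim]] by (auto simp: Bseq_def)
  obtain B where B: "\<And>k. k \<in> {1..d} \<Longrightarrow> norm (b k) \<le> B"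
    using finite_imageI[of "{1..d}" "\<lambda>k. norm (b k)"] Max_ge[of "(\<lambda>k. norm (b k)) ` {1..d}"]
    by (metis finite_atLeastAtMost imageI)
  have bd: "\<bar>\<phi> (s n) (b k)\<bar> \<le> M * B" if "k \<in> {1..d}" for n k
  proof -
    have "norm (s n) * norm (b k) \<le> M * B"
      using M[of n] B[OF that] order_trans[OF norm_ge_zero M[of n]] by (intro mult_mono) auto
    then show ?thesis using phi_le[of "s n" "b k"] by linarith
  qed
  obtain l r where r: "strict_mono (r :: nat \<Rightarrow> nat)"
    and l: "\<And>k. k \<in> {1..d} \<Longrightarrow> (\<lambda>n. \<phi> (s (r n)) (b k)) \<longlonglongrightarrow> l k"
    by (rule bolzano_weierstrass_finite_family[of "{1..d}" "\<lambda>n k. \<phi> (s n) (b k)" "M * B"])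
      (use bd in auto)
  obtain \<psi> where \<psi>: "linear \<psi>" "\<And>k. k \<in> {1..d} \<Longrightarrow> \<psi> (b k) = l k"
    using linear_extension by blast
  have sr: "(\<lambda>n. s (r n)) \<longlonglongrightarrow> x"
    using LIMSEQ_subseq_LIMSEQ[OF s_lim r] by (simp add: o_def)
  have lim: "(\<lambda>n. \<phi> (s (r n)) (z n)) \<longlonglongrightarrow> \<psi> w" if "z \<longlonglongrightarrow> w" for z w
    by (rule linear_tendsto_pointwise[OF linear_phi \<psi>(1) _ that]) (simp add: l \<psi>(2))
  have "\<psi> = \<phi> x"
  proof (rule phi_eqI)
    have "(\<lambda>n. (norm (s (r n)))\<^sup>2) \<longlonglongrightarrow> \<psi> x"
      using lim[OF sr] by (simp add: phi_self)
    then show "\<psi> x = (norm x)\<^sup>2"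
      by (rule LIMSEQ_unique) (intro tendsto_intros sr)
    show "\<bar>\<psi> w\<bar> \<le> norm x * norm w" for w
    proof (rule LIMSEQ_le)
      show "(\<lambda>n. \<bar>\<phi> (s (r n)) w\<bar>) \<longlonglongrightarrow> \<bar>\<psi> w\<bar>"
        by (intro tendsto_intros lim)
      show "(\<lambda>n. norm (s (r n)) * norm w) \<longlonglongrightarrow> norm x * norm w"
        by (intro tendsto_intros sr)
    qed (auto simp: phi_le)
  qed (fact \<psi>)
  then have "(\<lambda>n. \<phi> (s (r n)) y) \<longlonglongrightarrow> \<phi> x y"
    using lim[OF tendsto_const] by simp
  then obtain n where "dist (\<phi> (s (r n)) y) (\<phi> x y) < e"
    using metric_LIMSEQ_D[OF _ e] by blast
  then show False using s_far by blast
qed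

lemma tendsto_phi:
  assumes "(f \<longlongrightarrow> x) F" "(g \<longlongrightarrow> y) F"
  shows "((\<lambda>t. \<phi> (f t) (g t)) \<longlongrightarrow> \<phi> x y) F"
  by (rule linear_tendsto_pointwise[OF linear_phi linear_phi _ assms(2)])
    (rule isCont_tendsto_compose[OF isCont_phi assms(1)])

text \<open>From \<phi> x y \<le> |x| |y| and the inequality of arithmetic and geometric means:
  \<phi> x is a subgradient of half the squared norm at \<open>x\<close>.\<close>

lemma phi_subgradient: "\<phi> x (y - x) \<le> ((norm y)\<^sup>2 - (norm x)\<^sup>2) / 2"
proof -
  have "\<phi> x y \<le> norm x * norm y" using phi_le[of x y] by linarith
  moreover have "2 * (norm x * norm y) \<le> (norm x)\<^sup>2 + (norm y)\<^sup>2"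
    using sum_squares_bound[of "norm x" "norm y"] by (simp add: mult.assoc)
  ultimately show ?thesis
    by (simp add: linear_diff[OF linear_phi] phi_self field_simps)
qed

text \<open>The subgradient inequalities at \<open>c t\<close> and at \<open>c s\<close> trap the
  difference quotient between the values of \<phi> (c t) and \<phi> (c s) on the quotient of
  \<open>c\<close>; both have the same limit by continuity of the duality map. The minimum and
  maximum cover both signs of \<open>s - t\<close>.\<close>

lemma norm_square_has_derivative_curve:
  fixes c :: "real \<Rightarrow> 'a"
  assumes "(c has_vector_derivative c') (at t)"
  shows "((\<lambda>s. (norm (c s))\<^sup>2 / 2) has_real_derivative \<phi> (c t) c') (at t)"
proof -
  let ?\<Delta> = "\<lambda>s. (c s - c t) /\<^sub>R (s - t)"
  have \<Delta>: "(?\<Delta> \<longlongrightarrow> c') (at t)"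
    by (rule has_vector_derivative_tendsto_quotient[OF assms])
  have c: "(c \<longlongrightarrow> c t) (at t)"
    using has_vector_derivative_continuous[OF assms] by (simp add: continuous_within)
  let ?A = "\<lambda>s. \<phi> (c t) (?\<Delta> s)" and ?B = "\<lambda>s. \<phi> (c s) (?\<Delta> s)"
  have A: "(?A \<longlongrightarrow> \<phi> (c t) c') (at t)" by (intro tendsto_phi tendsto_const \<Delta>)
  have B: "(?B \<longlongrightarrow> \<phi> (c t) c') (at t)" by (intro tendsto_phi c \<Delta>)
  let ?q = "\<lambda>s. ((norm (c s))\<^sup>2 / 2 - (norm (c t))\<^sup>2 / 2) / (s - t)"
  have between: "min (?A s) (?B s) \<le> ?q s \<and> ?q s \<le> max (?A s) (?B s)" if "s \<noteq> t" for s
  proof -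
    have 1: "\<phi> (c t) (c s - c t) \<le> (norm (c s))\<^sup>2 / 2 - (norm (c t))\<^sup>2 / 2"
      using phi_subgradient[of "c t" "c s"] by simp
    have 2: "(norm (c s))\<^sup>2 / 2 - (norm (c t))\<^sup>2 / 2 \<le> \<phi> (c s) (c s - c t)"
      using phi_subgradient[of "c s" "c t"] by (simp add: linear_diff[OF linear_phi])
    have q: "\<phi> y (?\<Delta> s) = \<phi> y (c s - c t) / (s - t)" for y
      by (simp only: linear_scale[OF linear_phi] divide_inverse real_scaleR_def mult.commute)
    show ?thesis
    proof (cases "s > t")
      case True
      have "?A s \<le> ?q s" "?q s \<le> ?B s"
        unfolding q using True by (intro divide_right_mono 1 2; simp)+
      then show ?thesis by linarith
    next
      case False
      then have "s - t < 0" using that by simp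
      have "?q s \<le> ?A s" "?B s \<le> ?q s"
        unfolding q using \<open>s - t < 0\<close> by (intro divide_right_mono_neg 1 2; simp)+
      then show ?thesis by linarith
    qed
  qed
  have "(?q \<longlongrightarrow> \<phi> (c t) c') (at t)"
  proof (rule tendsto_sandwich)
    show "((\<lambda>s. min (?A s) (?B s)) \<longlongrightarrow> \<phi> (c t) c') (at t)"
      using tendsto_min[OF A B] by simp
    show "((\<lambda>s. max (?A s) (?B s)) \<longlongrightarrow> \<phi> (c t) c') (at t)"
      using tendsto_max[OF A B] by simp
    show "\<forall>\<^sub>F s in at t. min (?A s) (?B s) \<le> ?q s"
      using between by (auto simp: eventually_at_filter)
    show "\<forall>\<^sub>F s in at t. ?q s \<le> max (?A s) (?B s)"
      using between by (auto simp: eventually_at_filter)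
  qed
  then show ?thesis by (simp add: has_field_derivative_iff)
qed

text \<open>Equality in the triangle inequality forces proportional vectors, and the prescribed
  norms then fix the factor. Hence a point of a segment is determined by its distances to the two
  ends.\<close>

lemma metric_division_point_unique:
  fixes x y :: 'a
  assumes "norm x = s * norm (x + y)" "norm y = (1 - s) * norm (x + y)" "0 \<le> s" "s \<le> 1"
  shows "x = s *\<^sub>R (x + y)"
proof -
  consider "x = 0" | "x \<noteq> 0" "y = 0" | "x \<noteq> 0" "y \<noteq> 0" by blast
  then show ?thesis
  proof cases
    case 1
    then have "s * norm (x + y) = 0" using assms(1) by simp
    then show ?thesis using 1 by auto
  next
    case 2
    then have "(1 - s) * norm (x + y) = 0" using assms(2) by simp
    then show ?thesis using 2 by auto
  next
    case 3
    have "norm (x + y) = norm x + norm y" using assms by (simp add: algebra_simps)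
    then have "\<not> norm (x + y) < norm x + norm y" by simp
    then obtain k where k: "x = k *\<^sub>R y"
      using strictly_convex 3 unfolding strictly_convex_space_def by blast
    have xy: "x + y = (k + 1) *\<^sub>R y" using k by (simp add: algebra_simps)
    have "\<bar>k + 1\<bar> * norm y = norm (x + y)" unfolding xy by simp
    also have "\<dots> = (\<bar>k\<bar> + 1) * norm y"
      unfolding \<open>norm (x + y) = norm x + norm y\<close> by (simp add: k distrib_right)
    finally have "\<bar>k + 1\<bar> * norm y = (\<bar>k\<bar> + 1) * norm y" .
    then have "k \<ge> 0" using 3 by simp
    have "k * norm y = s * ((k + 1) * norm y)"
      using assms(1) \<open>k \<ge> 0\<close> unfolding xy by (simp add: k)
    then have "k = s * (k + 1)" using 3 by simp
    then show ?thesis unfolding xy by (simp add: k)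
  qed
qed

text \<open>Distances determine the division points of a segment, so they are preserved. With 0 as
  one end this gives homogeneity on [0, 1], then for s > 1 by applying it with 1 / s. Additivity
  follows because x + y is twice the midpoint of x and y.\<close>

lemma isometry_imp_linear:
  fixes T :: "'a \<Rightarrow> 'a"
  assumes "isometry T"
  shows "linear (\<lambda>x. T x - T 0)"
proof -
  define S where "S = (\<lambda>x. T x - T 0)"
  have S0: "S 0 = 0" by (simp add: S_def)
  have dist: "norm (S x - S y) = norm (x - y)" for x y
    using assms by (simp add: S_def isometry_def dist_norm)
  have segment: "S (x + s *\<^sub>R (y - x)) = S x + s *\<^sub>R (S y - S x)" if "0 \<le> s" "s \<le> 1" for x y s
  proof -
    define z where "z = x + s *\<^sub>R (y - x)"
    have *: "S z - S x + (S y - S z) = S y - S x" by simp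
    have "norm (S z - S x) = s * norm (S y - S x)"
      using that by (simp add: dist z_def)
    moreover have "norm (S y - S z) = (1 - s) * norm (S y - S x)"
    proof -
      have "y - z = (1 - s) *\<^sub>R (y - x)" by (simp add: z_def algebra_simps)
      then show ?thesis using that by (simp add: dist)
    qed
    ultimately have "S z - S x = s *\<^sub>R (S z - S x + (S y - S z))"
      using that by (intro metric_division_point_unique) (simp_all only: *)
    then show ?thesis unfolding z_def[symmetric] * by (simp add: algebra_simps)
  qed
  have scale01: "S (s *\<^sub>R x) = s *\<^sub>R S x" if "0 \<le> s" "s \<le> 1" for s x
    using segment[OF that, of 0 x] S0 by simp
  have scale_pos: "S (s *\<^sub>R x) = s *\<^sub>R S x" if "0 \<le> s" for s x
  proof (cases "s \<le> 1")
    case True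
    then show ?thesis using scale01 that by blast
  next
    case False
    then have "S ((1 / s) *\<^sub>R (s *\<^sub>R x)) = (1 / s) *\<^sub>R S (s *\<^sub>R x)"
      by (intro scale01) auto
    then show ?thesis using False by simp
  qed
  have add: "S (x + y) = S x + S y" for x y
  proof -
    have "x + y = 2 *\<^sub>R (x + (1/2) *\<^sub>R (y - x))"
      by (simp add: algebra_simps scaleR_2)
    then have "S (x + y) = 2 *\<^sub>R (S x + (1/2) *\<^sub>R (S y - S x))"
      using scale_pos[of 2 "x + (1/2) *\<^sub>R (y - x)"] segment[of "1/2" x y] by simp
    also have "\<dots> = S x + S y"
      by (simp add: scaleR_2 algebra_simps)
    finally show ?thesis .
  qed
  have neg: "S (- x) = - S x" for x
    using add[of x "- x"] S0 by (simp add: eq_neg_iff_add_eq_0 add.commute)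
  have "S (s *\<^sub>R x) = s *\<^sub>R S x" for s x
    using scale_pos[of s x] scale_pos[of "- s" x] neg[of "s *\<^sub>R x"] by (cases "s \<ge> 0") auto
  then have "linear S" using add by (intro linearI) auto
  then show ?thesis by (simp add: S_def)
qed

definition linear_isometry :: "('a \<Rightarrow> 'a) \<Rightarrow> bool" where
  "linear_isometry L \<longleftrightarrow> linear L \<and> (\<forall>x. norm (L x) = norm x)"

lemma linear_isometry_bij: "linear_isometry L \<Longrightarrow> bij L"
proof (rule linear_inj_imp_bij)
  assume L: "linear_isometry L"
  then show "linear L" by (simp add: linear_isometry_def)
  then show "inj L"
    using L by (metis linear_injective_0 linear_isometry_def norm_eq_zero)
qed

lemma linear_isometry_inv:
  assumes "linear_isometry L"
  shows "linear_isometry (inv L)"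
  unfolding linear_isometry_def
proof (intro conjI allI)
  have L: "linear L" "\<And>x. L (inv L x) = x" "inj L"
    using assms linear_isometry_bij[OF assms] by (auto simp: linear_isometry_def bij_def surj_f_inv_f)
  show "linear (inv L)"
    by (intro linearI inv_f_eq L(3)) (simp_all add: L linear_add[OF L(1)] linear_scale[OF L(1)])
  show "norm (inv L x) = norm x" for x
    using assms L(2)[of x] by (metis linear_isometry_def)
qed

lemma linear_isometry_compose:
  "linear_isometry L \<Longrightarrow> linear_isometry M \<Longrightarrow> linear_isometry (\<lambda>x. L (M x))"
  using linear_compose[of M L] by (auto simp: linear_isometry_def o_def)

lemma linear_isometry_id: "linear_isometry (\<lambda>x. x)"
  by (simp add: linear_isometry_def linear_iff)

end

section \<open>One-parameter groups of isometries and their limits\<close>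

context based_space
begin

text \<open>\<open>flow Z t\<close> is \<open>exp (t Z)\<close>, with the series taken in coordinates because \<open>'a\<close> is not
  known to be complete as a type.\<close>

definition flow :: "('a \<Rightarrow> 'a) \<Rightarrow> real \<Rightarrow> 'a \<Rightarrow> 'a" where
  "flow Z t x = (\<Sum>k\<in>{1..d}. (\<Sum>n. coord k ((Z ^^ n) x) / fact n * t ^ n) *\<^sub>R b k)"

lemma linear_funpow: "linear Z \<Longrightarrow> linear (Z ^^ n)" for Z :: "'a \<Rightarrow> 'a"
  by (induction n) (auto simp: linear_iff)

lemma summable_flow:
  fixes Z :: "'a \<Rightarrow> 'a"
  assumes "linear Z" "k \<in> {1..d}"
  shows "summable (\<lambda>n. coord k ((Z ^^ n) x) / fact n * t ^ n)"
proof -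
  obtain K where K: "K > 0" "\<And>x. norm (Z x) \<le> norm x * K"
    using bounded_linear.pos_bounded[OF bounded_linear_if_linear[OF assms(1)]] by blast
  obtain C where C: "C > 0" "\<And>k x. k \<in> {1..d} \<Longrightarrow> \<bar>coord k x\<bar> \<le> C * norm x"
    using coord_bounded by blast
  have pow: "norm ((Z ^^ n) x) \<le> K ^ n * norm x" for n
  proof (induction n)
    case (Suc n)
    have "norm ((Z ^^ Suc n) x) \<le> norm ((Z ^^ n) x) * K" using K(2) by simp
    also have "\<dots> \<le> (K ^ n * norm x) * K" using Suc K(1) by (intro mult_right_mono) auto
    finally show ?case by (simp add: mult_ac)
  qed simp
  have "norm (coord k ((Z ^^ n) x) / fact n * t ^ n) \<le> (C * norm x) * norm ((K * t) ^ n /\<^sub>R fact n)" for n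
  proof -
    have "\<bar>coord k ((Z ^^ n) x)\<bar> \<le> C * (K ^ n * norm x)"
      using C(2)[OF assms(2)] mult_left_mono[OF pow[of n], of C] C(1)
      by (meson less_imp_le order_trans)
    then have "\<bar>coord k ((Z ^^ n) x)\<bar> * (\<bar>t ^ n\<bar> / fact n) \<le> C * (K ^ n * norm x) * (\<bar>t ^ n\<bar> / fact n)"
      by (intro mult_right_mono) auto
    then show ?thesis
      using K(1) by (simp add: abs_mult power_mult_distrib field_simps)
  qed
  moreover have "summable (\<lambda>n. (C * norm x) * norm ((K * t) ^ n /\<^sub>R fact n))"
    by (intro summable_mult summable_norm_exp)
  ultimately show ?thesis
    by (rule summable_comparison_test'[rotated])
qed

text \<open>Tested against any functional, the flow is a scalar exponential series. Identities for
  \<open>flow\<close> then reduce to uniqueness of sums, coordinate by coordinate.\<close>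

lemma flow_sums:
  fixes g :: "'a \<Rightarrow> real"
  assumes Z: "linear Z" and g: "linear g"
  shows "(\<lambda>n. g ((Z ^^ n) x) / fact n * t ^ n) sums g (flow Z t x)"
proof -
  have "(\<lambda>n. \<Sum>k\<in>{1..d}. (coord k ((Z ^^ n) x) / fact n * t ^ n) * g (b k)) sums
      (\<Sum>k\<in>{1..d}. (\<Sum>n. coord k ((Z ^^ n) x) / fact n * t ^ n) * g (b k))"
    by (intro sums_sum sums_mult2 summable_sums summable_flow Z)
  moreover have "g (flow Z t x) = (\<Sum>k\<in>{1..d}. (\<Sum>n. coord k ((Z ^^ n) x) / fact n * t ^ n) * g (b k))"
    by (simp add: flow_def linear_sum[OF g] linear_scale[OF g])
  moreover have "g ((Z ^^ n) x) / fact n * t ^ n =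
      (\<Sum>k\<in>{1..d}. (coord k ((Z ^^ n) x) / fact n * t ^ n) * g (b k))" for n
    by (subst linear_expand[OF g, of "(Z ^^ n) x"]) (simp add: sum_divide_distrib sum_distrib_left sum_distrib_right mult_ac)
  ultimately show ?thesis by simp
qed

lemma eq_if_coord_eq:
  assumes "\<And>k. k \<in> {1..d} \<Longrightarrow> coord k x = coord k y" shows "x = y"
proof -
  have "(\<Sum>k\<in>{1..d}. coord k x *\<^sub>R b k) = (\<Sum>k\<in>{1..d}. coord k y *\<^sub>R b k)"
    by (rule sum.cong) (simp_all add: assms)
  then show ?thesis by (simp only: sum_coord)
qed

lemma flow_commute:
  assumes "linear Z" shows "flow Z t (Z x) = Z (flow Z t x)"
proof (rule eq_if_coord_eq)
  fix k
  have "linear (\<lambda>y. coord k (Z y))"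
    using linear_compose[OF assms linear_coord] by (simp add: o_def)
  from flow_sums[OF assms this, of x t]
  have "(\<lambda>n. coord k ((Z ^^ n) (Z x)) / fact n * t ^ n) sums coord k (Z (flow Z t x))"
    by (simp add: funpow_swap1)
  then show "coord k (flow Z t (Z x)) = coord k (Z (flow Z t x))"
    by (rule sums_unique2[OF flow_sums[OF assms linear_coord]])
qed

lemma flow_0_time:
  assumes "linear Z" shows "flow Z 0 x = x"
proof (rule eq_if_coord_eq)
  fix k
  have "(\<lambda>n. coord k ((Z ^^ n) x) / fact n * 0 ^ n) sums (coord k ((Z ^^ 0) x) / fact 0)"
    by (rule powser_sums_zero)
  then show "coord k (flow Z 0 x) = coord k x"
    using sums_unique2[OF flow_sums[OF assms linear_coord]] by simp
qed

lemma linear_flow: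
  assumes "linear Z" shows "linear (flow Z t)"
proof (rule linearI; rule eq_if_coord_eq)
  fix x y k
  note S = flow_sums[OF assms linear_coord, of k]
  have "(\<lambda>n. coord k ((Z ^^ n) (x + y)) / fact n * t ^ n) sums (coord k (flow Z t x) + coord k (flow Z t y))"
    using sums_add[OF S S, of x t y t]
    by (simp add: linear_add[OF linear_funpow[OF assms]] linear_add[OF linear_coord] add_divide_distrib distrib_right)
  then show "coord k (flow Z t (x + y)) = coord k (flow Z t x + flow Z t y)"
    unfolding linear_add[OF linear_coord] by (rule sums_unique2[OF S])
next
  fix x c k
  note S = flow_sums[OF assms linear_coord, of k]
  have "(\<lambda>n. coord k ((Z ^^ n) (c *\<^sub>R x)) / fact n * t ^ n) sums (c * coord k (flow Z t x))"
    using sums_mult[OF S, of c x t]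
    by (simp add: linear_scale[OF linear_funpow[OF assms]] linear_scale[OF linear_coord] mult.assoc)
  then have "coord k (flow Z t (c *\<^sub>R x)) = c * coord k (flow Z t x)"
    by (rule sums_unique2[OF S])
  then show "coord k (flow Z t (c *\<^sub>R x)) = coord k (c *\<^sub>R flow Z t x)"
    by (simp add: linear_scale[OF linear_coord])
qed

lemma flow_has_vector_derivative:
  assumes "linear Z"
  shows "((\<lambda>t. flow Z t x) has_vector_derivative flow Z t (Z x)) (at t)"
proof -
  have "((\<lambda>t. \<Sum>n. coord k ((Z ^^ n) x) / fact n * t ^ n) has_vector_derivative
      (\<Sum>n. coord k ((Z ^^ n) (Z x)) / fact n * t ^ n)) (at t)" if "k \<in> {1..d}" for k
  proof -
    \<comment> \<open>Termwise differentiation shifts the coefficients of \<open>x\<close> to those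
      of \<open>Z x\<close>.\<close>
    have "diffs (\<lambda>n. coord k ((Z ^^ n) x) / fact n) = (\<lambda>n. coord k ((Z ^^ n) (Z x)) / fact n)"
      by (rule ext) (simp add: diffs_def funpow_swap1 del: of_nat_Suc)
    then show ?thesis
      using termdiffs_strong_converges_everywhere[OF summable_flow[OF assms that], of x t]
      by (simp add: has_real_derivative_iff_has_vector_derivative)
  qed
  then have "((\<lambda>t. \<Sum>k\<in>{1..d}. (\<Sum>n. coord k ((Z ^^ n) x) / fact n * t ^ n) *\<^sub>R b k) has_vector_derivative
      (\<Sum>k\<in>{1..d}. (\<Sum>n. coord k ((Z ^^ n) (Z x)) / fact n * t ^ n) *\<^sub>R b k)) (at t)"
    by (intro has_vector_derivative_sum bounded_linear.has_vector_derivative[OF bounded_linear_scaleR_left])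
  then show ?thesis by (simp add: flow_def)
qed

lemma flow_fixed:
  assumes "linear Z" "Z x = 0" shows "flow Z t x = x"
proof (rule eq_if_coord_eq)
  fix k
  have "(Z ^^ n) x = 0" if "n > 0" for n
    using that linear_0[OF linear_funpow[OF assms(1)]] by (auto simp: assms(2) gr0_conv_Suc funpow_swap1)
  then have "(\<lambda>n. coord k ((Z ^^ n) x) / fact n * t ^ n) sums (\<Sum>n\<in>{0}. coord k ((Z ^^ n) x) / fact n * t ^ n)"
    by (intro sums_finite) (auto simp: coord_0)
  then show "coord k (flow Z t x) = coord k x"
    using sums_unique2[OF flow_sums[OF assms(1) linear_coord]] by simp
qed

end

context smooth_strictly_convex_space
begin

text \<open>The Lie algebra of the group of linear isometries: since \<phi> y is the derivative of
  half the squared norm at \<open>y\<close>, the condition says that the linear field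
  \<open>Z\<close> is tangent to all spheres about 0.\<close>

definition infinitesimal_isometry :: "('a \<Rightarrow> 'a) \<Rightarrow> bool" where
  "infinitesimal_isometry Z \<longleftrightarrow> linear Z \<and> (\<forall>y. \<phi> y (Z y) = 0)"

lemma linear_isometry_flow:
  assumes "infinitesimal_isometry Z" shows "linear_isometry (flow Z t)"
proof -
  have Z: "linear Z" "\<And>y. \<phi> y (Z y) = 0" using assms by (auto simp: infinitesimal_isometry_def)
  have "norm (flow Z t x) = norm x" for x
  proof -
    have "((\<lambda>s. (norm (flow Z s x))\<^sup>2 / 2) has_real_derivative 0) (at s)" for s
      using norm_square_has_derivative_curve[OF flow_has_vector_derivative[OF Z(1), of x s]]
      by (simp add: flow_commute[OF Z(1)] Z(2))
    then have "(norm (flow Z t x))\<^sup>2 / 2 = (norm (flow Z 0 x))\<^sup>2 / 2"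
      by (intro DERIV_isconst_all) auto
    then show ?thesis by (simp add: flow_0_time[OF Z(1)])
  qed
  then show ?thesis using linear_flow[OF Z(1)] by (simp add: linear_isometry_def)
qed

section \<open>Limits of isometries rescaled by their displacement\<close>

lemma opsize_scaleR: "opsize (\<lambda>x. c *\<^sub>R f x) = \<bar>c\<bar> * opsize f"
  by (simp add: opsize_def sum_distrib_left)

lemma opsize_tendsto:
  assumes "\<And>x. ((\<lambda>n. f n x) \<longlongrightarrow> g x) F"
  shows "((\<lambda>n. opsize (f n)) \<longlongrightarrow> opsize g) F"
  unfolding opsize_def by (intro tendsto_intros assms)

lemma linear_isometry_diff_linear:
  "linear_isometry M \<Longrightarrow> linear (\<lambda>x. M x - x)"
  by (simp add: linear_isometry_def linear_iff algebra_simps)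

lemma linear_isometry_norm: "linear_isometry M \<Longrightarrow> norm (M x) = norm x"
  by (simp add: linear_isometry_def)

text \<open>Isometries that agree on all \<open>y v\<close> are interchangeable; choosing one that is almost closest
  to the identity rules out a large motion in the directions not spanned by the \<open>y v\<close>.\<close>

lemma almost_minimal_coset_element:
  fixes y :: "'v \<Rightarrow> 'a"
  assumes L: "linear_isometry L"
  obtains M where "linear_isometry M" "\<And>v. v \<in> V \<Longrightarrow> M (y v) = L (y v)"
    and "\<And>N. linear_isometry N \<Longrightarrow> (\<And>v. v \<in> V \<Longrightarrow> N (y v) = L (y v)) \<Longrightarrow>
      opsize (\<lambda>x. M x - x) \<le> 2 * opsize (\<lambda>x. N x - x)"
proof -
  define \<C> where "\<C> = {M. linear_isometry M \<and> (\<forall>v\<in>V. M (y v) = L (y v))}"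
  define g where "g = (\<lambda>M :: 'a \<Rightarrow> 'a. opsize (\<lambda>x. M x - x))"
  have ne: "g ` \<C> \<noteq> {}" using L by (auto simp: \<C>_def)
  have bdd: "bdd_below (g ` \<C>)" by (rule bdd_belowI2[of _ 0]) (simp add: g_def opsize_nonneg)
  \<comment> \<open>The infimum of the displacements need not be known to be attained. If it is
    positive, some element lies below twice the infimum. If it is 0, then \<open>L\<close> must fix
    every \<open>y v\<close>, and the identity is itself a candidate.\<close>
  have "\<exists>M\<in>\<C>. \<forall>N\<in>\<C>. g M \<le> 2 * g N"
  proof (cases "Inf (g ` \<C>) > 0")
    case True
    then have "Inf (g ` \<C>) < 2 * Inf (g ` \<C>)" by simp
    then obtain M where M: "M \<in> \<C>" "g M < 2 * Inf (g ` \<C>)"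
      using cInf_lessD[OF ne] by blast
    have "Inf (g ` \<C>) \<le> g N" if "N \<in> \<C>" for N
      using bdd that by (rule cINF_lower)
    then show ?thesis using M by force
  next
    case False
    obtain C where C: "C > 0" "\<And>(f :: 'a \<Rightarrow> 'a) x. linear f \<Longrightarrow> norm (f x) \<le> C * opsize f * norm x"
      using opsize_bound[where 'c='a] by metis
    have "L (y v) = y v" if v: "v \<in> V" for v
    proof (rule ccontr)
      assume ne': "L (y v) \<noteq> y v"
      \<comment> \<open>Chosen so that a displacement below \<open>e\<close> moves
        \<open>y v\<close> by less than \<open>L\<close> does; the \<open>+ 1\<close> keeps the
        denominator positive.\<close>
      define e where "e = norm (L (y v) - y v) / (C * (norm (y v) + 1))"
      have den: "C * (norm (y v) + 1) > 0" using C(1) by (simp add: add_nonneg_pos)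
      have "e > 0" using ne' den by (simp add: e_def)
      then obtain M where M: "M \<in> \<C>" "g M < e"
        using cInf_lessD[OF ne, of e] False by force
      have "norm (L (y v) - y v) = norm (M (y v) - y v)"
        using M(1) v by (simp add: \<C>_def)
      also have "\<dots> \<le> C * g M * norm (y v)"
        using C(2)[OF linear_isometry_diff_linear, of M "y v"] M(1) by (simp add: \<C>_def g_def)
      also have "\<dots> \<le> C * g M * (norm (y v) + 1)"
        using C(1) by (intro mult_left_mono mult_nonneg_nonneg) (auto simp: g_def opsize_nonneg)
      also have "\<dots> < C * e * (norm (y v) + 1)"
        using M(2) C(1) by (intro mult_strict_right_mono mult_strict_left_mono) (auto simp: add_nonneg_pos)
      also have "\<dots> = norm (L (y v) - y v)"
        using den by (auto simp: e_def)
      finally show False by simp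
    qed
    then have "(\<lambda>x. x) \<in> \<C>" by (simp add: \<C>_def linear_isometry_id)
    moreover have "g (\<lambda>x. x) = 0" by (simp add: g_def opsize_def)
    ultimately show ?thesis
      by (intro bexI[of _ "\<lambda>x. x"]) (auto simp: g_def opsize_nonneg)
  qed
  then show ?thesis using that unfolding \<C>_def g_def by blast
qed

text \<open>A subsequential limit \<open>G\<close> of nearly minimal representatives is an isometry
  fixing every \<open>y v\<close>. Precomposing with \<open>inv G\<close> therefore stays among the
  competitors, and these composites tend to the identity; near-minimality forces the displacements
  of the representatives to 0 as well.\<close>

lemma almost_minimal_coset_sequence:
  fixes y :: "'v \<Rightarrow> 'a"
  assumes L: "\<And>n. linear_isometry (L n)" and fixed: "\<And>v. v \<in> V \<Longrightarrow> (\<lambda>n. L n (y v)) \<longlonglongrightarrow> y v"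
  obtains s M where "strict_mono (s :: nat \<Rightarrow> nat)" "\<And>n. linear_isometry (M n)"
    "\<And>n v. v \<in> V \<Longrightarrow> M n (y v) = L (s n) (y v)"
    and "\<And>n. \<forall>N. linear_isometry N \<longrightarrow> (\<forall>v\<in>V. N (y v) = M n (y v)) \<longrightarrow>
      opsize (\<lambda>x. M n x - x) \<le> 2 * opsize (\<lambda>x. N x - x)"
    and "(\<lambda>n. opsize (\<lambda>x. M n x - x)) \<longlonglongrightarrow> 0"
proof -
  have "\<forall>n. \<exists>M. linear_isometry M \<and> (\<forall>v\<in>V. M (y v) = L n (y v)) \<and>
    (\<forall>N. linear_isometry N \<longrightarrow> (\<forall>v\<in>V. N (y v) = L n (y v)) \<longrightarrow>
      opsize (\<lambda>x. M x - x) \<le> 2 * opsize (\<lambda>x. N x - x))"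
    by (rule allI, rule almost_minimal_coset_element[OF L, of V y]) blast
  then obtain M where M: "\<And>n. linear_isometry (M n)" "\<And>n v. v \<in> V \<Longrightarrow> M n (y v) = L n (y v)"
    and min: "\<And>n N. linear_isometry N \<Longrightarrow> (\<forall>v\<in>V. N (y v) = L n (y v)) \<Longrightarrow>
      opsize (\<lambda>x. M n x - x) \<le> 2 * opsize (\<lambda>x. N x - x)"
    by metis
  have Mlin: "\<And>n. linear (M n)" using M(1) by (simp add: linear_isometry_def)
  have "norm (M n (b k)) \<le> (\<Sum>k\<in>{1..d}. norm (b k))" if "k \<in> {1..d}" for n k
    using member_le_sum[OF that, of "\<lambda>k. norm (b k)"] linear_isometry_norm[OF M(1)] by simp
  note bd = this
  obtain G s where s: "strict_mono (s :: nat \<Rightarrow> nat)" and G: "linear G" "\<And>x. (\<lambda>n. M (s n) x) \<longlonglongrightarrow> G x"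
    using operator_convergent_subsequence[of M, OF Mlin bd] by blast
  have isoG: "linear_isometry G"
    unfolding linear_isometry_def
  proof (intro conjI allI G(1))
    fix x
    have "(\<lambda>n. norm (M (s n) x)) \<longlonglongrightarrow> norm (G x)" by (intro tendsto_norm G(2))
    then have "(\<lambda>n. norm x) \<longlonglongrightarrow> norm (G x)"
      by (simp only: linear_isometry_norm[OF M(1)])
    then show "norm (G x) = norm x" by (simp add: LIMSEQ_const_iff)
  qed
  have Gfix: "inv G (y v) = y v" if v: "v \<in> V" for v
  proof -
    have "(\<lambda>n. M (s n) (y v)) \<longlonglongrightarrow> y v"
      using LIMSEQ_subseq_LIMSEQ[OF fixed[OF v] s] by (simp add: o_def M(2)[OF v])
    then have "G (y v) = y v" using G(2) LIMSEQ_unique by blast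
    then show ?thesis using linear_isometry_bij[OF isoG] by (metis bij_inv_eq_iff)
  qed
  have up: "opsize (\<lambda>x. M (s n) x - x) \<le> 2 * opsize (\<lambda>x. M (s n) (inv G x) - x)" for n
  proof (rule min)
    show "linear_isometry (\<lambda>x. M (s n) (inv G x))"
      by (rule linear_isometry_compose[OF M(1) linear_isometry_inv[OF isoG]])
  qed (simp add: Gfix M(2))
  have "(\<lambda>n. opsize (\<lambda>x. M (s n) (inv G x) - x)) \<longlonglongrightarrow> opsize (\<lambda>x. G (inv G x) - x)"
    by (intro opsize_tendsto tendsto_intros G(2))
  moreover have "G (inv G x) = x" for x
    using linear_isometry_bij[OF isoG] by (simp add: bij_def surj_f_inv_f)
  ultimately have "(\<lambda>n. opsize (\<lambda>x. M (s n) (inv G x) - x)) \<longlonglongrightarrow> 0"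
    by (simp add: opsize_def)
  then have up0: "(\<lambda>n. 2 * opsize (\<lambda>x. M (s n) (inv G x) - x)) \<longlonglongrightarrow> 0"
    using tendsto_mult_right_zero by blast
  have "(\<lambda>n. opsize (\<lambda>x. M (s n) x - x)) \<longlonglongrightarrow> 0"
    by (rule tendsto_sandwich[OF _ _ tendsto_const up0]) (simp_all add: up opsize_nonneg)
  then show ?thesis
    using that[OF s, of "\<lambda>n. M (s n)"] M min by auto
qed

text \<open>As \<open>M n\<close> preserves norms, the subgradient inequality at \<open>x\<close>
  makes the limit nonpositive, and the one at \<open>M n x\<close> makes the same limit
  nonnegative.\<close>

lemma infinitesimal_isometry_limit:
  assumes M: "\<And>n. linear_isometry (M n)" and r: "\<And>n. r n \<ge> (0::real)"
    and M_lim: "\<And>x. (\<lambda>n. M n x) \<longlonglongrightarrow> x"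
    and Z: "linear Z" "\<And>x. (\<lambda>n. (M n x - x) /\<^sub>R r n) \<longlonglongrightarrow> Z x"
  shows "infinitesimal_isometry Z"
  unfolding infinitesimal_isometry_def
proof (intro conjI allI Z(1))
  fix x
  have "\<phi> x ((M n x - x) /\<^sub>R r n) \<le> 0" for n
    using phi_subgradient[of x "M n x"] r[of n]
    by (simp add: linear_isometry_norm[OF M] linear_scale[OF linear_phi] mult_nonneg_nonpos)
  moreover have "(\<lambda>n. \<phi> x ((M n x - x) /\<^sub>R r n)) \<longlonglongrightarrow> \<phi> x (Z x)"
    by (intro tendsto_phi tendsto_const Z(2))
  ultimately have "\<phi> x (Z x) \<le> 0" by (intro LIMSEQ_le_const2) auto
  moreover have "\<phi> (M n x) ((M n x - x) /\<^sub>R r n) \<ge> 0" for n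
    using phi_subgradient[of "M n x" x] r[of n]
    by (simp add: linear_isometry_norm[OF M] linear_scale[OF linear_phi] linear_diff[OF linear_phi])
  moreover have "(\<lambda>n. \<phi> (M n x) ((M n x - x) /\<^sub>R r n)) \<longlonglongrightarrow> \<phi> x (Z x)"
    by (intro tendsto_phi M_lim Z(2))
  ultimately show "\<phi> x (Z x) = 0"
    by (intro antisym LIMSEQ_le_const) auto
qed

text \<open>Otherwise composing \<open>M n\<close> with the inverse of the flow of \<open>Z\<close>, which fixes all
  \<open>y v\<close>, would bring it much closer to the identity.\<close>

lemma almost_minimal_limit_nonzero:
  fixes y :: "'v \<Rightarrow> 'a"
  defines "r \<equiv> \<lambda>M. opsize (\<lambda>x. M x - x)"
  assumes M: "\<And>n. linear_isometry (M n)" and M_lim: "\<And>x. (\<lambda>n. M n x) \<longlonglongrightarrow> x"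
    and min: "\<And>n N. linear_isometry N \<Longrightarrow> (\<And>v. v \<in> V \<Longrightarrow> N (y v) = M n (y v)) \<Longrightarrow> r (M n) \<le> 2 * r N"
    and pos: "\<And>n. r (M n) > 0" and r0: "(\<lambda>n. r (M n)) \<longlonglongrightarrow> 0"
    and Z: "infinitesimal_isometry Z" "\<And>x. (\<lambda>n. (M n x - x) /\<^sub>R r (M n)) \<longlonglongrightarrow> Z x"
  shows "\<exists>v\<in>V. Z (y v) \<noteq> 0"
proof (rule ccontr)
  assume "\<not> ?thesis"
  then have Zy: "\<And>v. v \<in> V \<Longrightarrow> Z (y v) = 0" by blast
  have linZ: "linear Z" using Z(1) by (simp add: infinitesimal_isometry_def)
  define N where "N n = (\<lambda>x. M n (flow Z (- r (M n)) x))" for n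
  have N: "r (M n) \<le> 2 * r (N n)" for n
    unfolding N_def
    by (rule min[OF linear_isometry_compose[OF M linear_isometry_flow[OF Z(1)]]])
      (simp add: flow_fixed[OF linZ Zy])
  have scale: "opsize (\<lambda>x. (N n x - x) /\<^sub>R r (M n)) = r (N n) / r (M n)" for n
    unfolding opsize_scaleR using pos[of n] by (simp add: r_def divide_inverse mult.commute)
  have ge: "1 / 2 \<le> opsize (\<lambda>x. (N n x - x) /\<^sub>R r (M n))" for n
    unfolding scale using N[of n] pos[of n] by (simp add: field_simps)
  \<comment> \<open>On the scale \<open>r (M n)\<close>, the map \<open>M n\<close> contributes
    \<open>Z x\<close> and the backward flow contributes \<open>- Z x\<close>, so the composite
    moves nothing to first order. This contradicts the lower bound 1/2 in \<open>ge\<close>.\<close>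
  have "(\<lambda>n. (N n x - x) /\<^sub>R r (M n)) \<longlonglongrightarrow> 0" for x
  proof -
    have "((\<lambda>h. (flow Z h x - flow Z 0 x) /\<^sub>R (h - 0)) \<longlongrightarrow> flow Z 0 (Z x)) (at 0)"
      by (rule has_vector_derivative_tendsto_quotient[OF flow_has_vector_derivative[OF linZ]])
    then have q: "((\<lambda>h. (flow Z h x - x) /\<^sub>R h) \<longlongrightarrow> Z x) (at 0)"
      by (simp add: flow_0_time[OF linZ])
    have "filterlim (\<lambda>n. - r (M n)) (at 0) sequentially"
      unfolding filterlim_at using tendsto_minus[OF r0] pos by (auto simp: less_imp_neq[symmetric] intro!: always_eventually) 
    from filterlim_compose[OF q this]
    have "(\<lambda>n. (flow Z (- r (M n)) x - x) /\<^sub>R (- r (M n))) \<longlonglongrightarrow> Z x" .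
    note qlim = this
    have "linear (M n)" "linear (\<lambda>x. x :: 'a)" for n
      using M[of n] by (simp_all add: linear_isometry_def linear_iff)
    note linear_tendsto_pointwise[where f=M and g="\<lambda>x. x", OF this M_lim qlim]
    from tendsto_diff[OF Z(2)[of x] this]
    have "(\<lambda>n. (M n x - x) /\<^sub>R r (M n) - M n ((flow Z (- r (M n)) x - x) /\<^sub>R (- r (M n)))) \<longlonglongrightarrow> 0"
      by simp
    moreover have "(M n x - x) /\<^sub>R r (M n) - M n ((flow Z (- r (M n)) x - x) /\<^sub>R (- r (M n)))
      = (N n x - x) /\<^sub>R r (M n)" for n
    proof -
      have lin: "linear (M n)" using M by (simp add: linear_isometry_def)
      have "M n ((flow Z (- r (M n)) x - x) /\<^sub>R (- r (M n))) = - ((N n x - M n x) /\<^sub>R r (M n))"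
        by (simp only: linear_neg[OF lin] linear_scale[OF lin] linear_diff[OF lin] N_def inverse_minus_eq scaleR_minus_left)
      then show ?thesis by (simp add: scaleR_diff_right)
    qed
    ultimately show ?thesis by simp
  qed
  then have "(\<lambda>n. opsize (\<lambda>x. (N n x - x) /\<^sub>R r (M n))) \<longlonglongrightarrow> opsize (\<lambda>x. 0 :: 'a)"
    by (rule opsize_tendsto)
  then have "1 / 2 \<le> opsize (\<lambda>x. 0 :: 'a)"
    using ge by (intro LIMSEQ_le_const) auto
  then show False by (simp add: opsize_def)
qed

text \<open>The quotients by \<open>t n\<close> converge only at the points \<open>y v\<close>, and
  the \<open>L n\<close> may be wild elsewhere. Nearly minimal representatives divided by their own
  displacement have a convergent subsequence on the whole space; its limit, suitably scaled, is the
  required field.\<close>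

lemma infinitesimal_isometry_extension:
  fixes y w :: "'v \<Rightarrow> 'a"
  assumes L: "\<And>n. linear_isometry (L n)" and t: "\<And>n. t n > (0::real)" "t \<longlonglongrightarrow> 0"
    and w: "\<And>v. v \<in> V \<Longrightarrow> (\<lambda>n. (L n (y v) - y v) /\<^sub>R t n) \<longlonglongrightarrow> w v"
  shows "\<exists>Z. infinitesimal_isometry Z \<and> (\<forall>v\<in>V. Z (y v) = w v)"
proof (cases "\<forall>v\<in>V. w v = 0")
  case True
  then show ?thesis
    by (intro exI[of _ "\<lambda>_. 0"]) (simp add: infinitesimal_isometry_def linear_zero linear_0[OF linear_phi])
next
  case False
  then obtain v0 where v0: "v0 \<in> V" "w v0 \<noteq> 0" by blast
  have fixed: "(\<lambda>n. L n (y v)) \<longlonglongrightarrow> y v" if "v \<in> V" for v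
  proof -
    have "(\<lambda>n. t n *\<^sub>R ((L n (y v) - y v) /\<^sub>R t n) + y v) \<longlonglongrightarrow> 0 *\<^sub>R w v + y v"
      by (intro tendsto_intros t w that)
    moreover have "t n *\<^sub>R ((L n (y v) - y v) /\<^sub>R t n) + y v = L n (y v)" for n
      using t(1)[of n] by simp
    ultimately show ?thesis by simp
  qed
  let ?r = "\<lambda>M. opsize (\<lambda>x. M x - x)"
  obtain M s where s: "strict_mono (s :: nat \<Rightarrow> nat)" and M: "\<And>n. linear_isometry (M n)"
    and coset: "\<And>n v. v \<in> V \<Longrightarrow> M n (y v) = L (s n) (y v)"
    and min': "\<And>n. \<forall>N. linear_isometry N \<longrightarrow> (\<forall>v\<in>V. N (y v) = M n (y v)) \<longrightarrow> ?r (M n) \<le> 2 * ?r N"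
    and r0: "(\<lambda>n. ?r (M n)) \<longlonglongrightarrow> 0"
    by (rule almost_minimal_coset_sequence[of L V y, OF L fixed]) blast+
  have min: "?r (M n) \<le> 2 * ?r N" if "linear_isometry N" "\<And>v. v \<in> V \<Longrightarrow> N (y v) = M n (y v)" for n N
    using min'[of n] that by blast
  obtain C where C: "C > 0" "\<And>(f :: 'a \<Rightarrow> 'a) x. linear f \<Longrightarrow> norm (f x) \<le> C * opsize f * norm x"
    using opsize_bound[where 'c='a] by metis
  have small: "norm (M n x - x) \<le> C * ?r (M n) * norm x" for n x
    by (rule C(2)[OF linear_isometry_diff_linear[OF M]])
  have ts: "(\<lambda>n. (M n (y v) - y v) /\<^sub>R t (s n)) \<longlonglongrightarrow> w v" if "v \<in> V" for v
    using LIMSEQ_subseq_LIMSEQ[OF w[OF that] s] by (simp add: o_def coset[OF that])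
  have "\<forall>\<^sub>F n in sequentially. (M n (y v0) - y v0) /\<^sub>R t (s n) \<noteq> 0"
    using ts[OF v0(1)] v0(2) by (rule tendsto_imp_eventually_ne)
  then obtain n0 where "\<And>n. n \<ge> n0 \<Longrightarrow> (M n (y v0) - y v0) /\<^sub>R t (s n) \<noteq> 0"
    by (auto simp: eventually_sequentially)
  \<comment> \<open>As \<open>w v0\<close> is nonzero, \<open>M n\<close> eventually moves
    \<open>y v0\<close>. The finitely many earlier indices are skipped so that division by the
    displacement is legitimate.\<close>
  then have pos: "?r (M n) > 0" if "n \<ge> n0" for n
    using that small[of n "y v0"] opsize_nonneg[of "\<lambda>x. M n x - x"] by (cases "?r (M n) = 0") fastforce+
  define W where "W n = (\<lambda>x. (M n x - x) /\<^sub>R ?r (M n))" for n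
  have Wlin: "linear (W n)" for n
    using linear_compose[OF linear_isometry_diff_linear[OF M[of n]] linear_scale_self]
    by (simp add: W_def o_def)
  have Wbd: "norm (W n (b k)) \<le> 1" if "k \<in> {1..d}" for n k
  proof -
    have "norm (M n (b k) - b k) \<le> ?r (M n)"
      unfolding opsize_def by (rule member_le_sum[OF that]) auto
    then show ?thesis
      using opsize_nonneg[of "\<lambda>x. M n x - x"]
      by (cases "?r (M n) = 0") (simp_all add: W_def divide_inverse[symmetric] mult.commute)
  qed
  obtain Z q where q: "strict_mono (q :: nat \<Rightarrow> nat)" and Z: "linear Z" "\<And>x. (\<lambda>n. W (q n + n0) x) \<longlonglongrightarrow> Z x"
    using operator_convergent_subsequence[of "\<lambda>n. W (n + n0)" 1, OF Wlin Wbd] by auto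
  define h where "h n = q n + n0" for n
  have h: "strict_mono h" using q by (simp add: h_def strict_mono_def)
  have posh: "?r (M (h n)) > 0" for n by (rule pos) (simp add: h_def)
  have r0h: "(\<lambda>n. ?r (M (h n))) \<longlonglongrightarrow> 0"
    using LIMSEQ_subseq_LIMSEQ[OF r0 h] by (simp add: o_def)
  have M_lim: "(\<lambda>n. M (h n) x) \<longlonglongrightarrow> x" for x
  proof -
    have "(\<lambda>n. C * ?r (M (h n)) * norm x) \<longlonglongrightarrow> C * 0 * norm x"
      by (intro tendsto_intros r0h)
    then have lim0: "(\<lambda>n. C * ?r (M (h n)) * norm x) \<longlonglongrightarrow> 0" by simp
    have "(\<lambda>n. M (h n) x - x) \<longlonglongrightarrow> 0"
      by (rule Lim_null_comparison[OF always_eventually lim0]) (simp add: small)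
    then show ?thesis by (rule LIM_zero_cancel)
  qed
  have Zlim: "(\<lambda>n. (M (h n) x - x) /\<^sub>R ?r (M (h n))) \<longlonglongrightarrow> Z x" for x
    using Z(2)[of x] by (simp add: W_def h_def)
  have infZ: "infinitesimal_isometry Z"
    by (rule infinitesimal_isometry_limit[OF M opsize_nonneg M_lim Z(1) Zlim])
  have "\<exists>v\<in>V. Z (y v) \<noteq> 0"
    by (rule almost_minimal_limit_nonzero[of "\<lambda>n. M (h n)" V y Z, OF M M_lim min posh r0h infZ Zlim])
  then obtain v1 where v1: "v1 \<in> V" "Z (y v1) \<noteq> 0" by blast
  \<comment> \<open>The ratio of the two scales, displacement over time. Its convergence can be read
    off at \<open>v1\<close>, where the limit field does not vanish; the limit is the factor by
    which \<open>Z\<close> has to be multiplied.\<close>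
  define \<rho> where "\<rho> n = ?r (M (h n)) / t (s (h n))" for n
  have ratio: "(\<lambda>n. \<rho> n *\<^sub>R W (h n) (y v)) \<longlonglongrightarrow> w v" if "v \<in> V" for v
  proof -
    have "(\<lambda>n. (M (h n) (y v) - y v) /\<^sub>R t (s (h n))) \<longlonglongrightarrow> w v"
      using LIMSEQ_subseq_LIMSEQ[OF ts[OF that] h] by (simp add: o_def)
    moreover have "(M (h n) (y v) - y v) /\<^sub>R t (s (h n)) = \<rho> n *\<^sub>R W (h n) (y v)" for n
      using posh[of n] by (simp add: \<rho>_def W_def divide_inverse)
    ultimately show ?thesis by simp
  qed
  have WZ: "(\<lambda>n. W (h n) x) \<longlonglongrightarrow> Z x" for x using Z(2) by (simp add: h_def)
  have \<rho>_nonneg: "\<rho> n \<ge> 0" for n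
    using posh[of n] t(1)[of "s (h n)"] by (simp add: \<rho>_def)
  have "(\<lambda>n. norm (\<rho> n *\<^sub>R W (h n) (y v1)) / norm (W (h n) (y v1))) \<longlonglongrightarrow> norm (w v1) / norm (Z (y v1))"
    by (intro tendsto_intros ratio WZ v1) (simp add: v1)
  moreover have "\<forall>\<^sub>F n in sequentially. norm (\<rho> n *\<^sub>R W (h n) (y v1)) / norm (W (h n) (y v1)) = \<rho> n"
    using tendsto_imp_eventually_ne[OF WZ v1(2)]
    by eventually_elim (use \<rho>_nonneg in simp)
  ultimately have \<rho>: "\<rho> \<longlonglongrightarrow> norm (w v1) / norm (Z (y v1))" (is "_ \<longlonglongrightarrow> ?\<kappa>")
    by (rule Lim_transform_eventually)
  have "w v = ?\<kappa> *\<^sub>R Z (y v)" if "v \<in> V" for v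
    by (rule LIMSEQ_unique[OF ratio[OF that]]) (intro tendsto_intros \<rho> WZ)
  moreover have "infinitesimal_isometry (\<lambda>x. ?\<kappa> *\<^sub>R Z x)"
    using infZ Z(1) linear_scale[OF linear_phi] by (auto simp: infinitesimal_isometry_def linear_iff algebra_simps)
  ultimately show ?thesis by (intro exI[of _ "\<lambda>x. ?\<kappa> *\<^sub>R Z x"]) simp
qed

end

section \<open>The tangent space of the orbit of a placement\<close>

context smooth_strictly_convex_space
begin

lemma flow_curve_in_tangent_space:
  fixes p :: "'v \<Rightarrow> 'a"
  assumes p: "p \<in> configurations V" and Z: "infinitesimal_isometry Z"
  shows "(\<lambda>v. if v \<in> V then Z (p v) + a else 0) \<in> tangent_space V p"
proof -
  have lin: "linear Z" using Z by (simp add: infinitesimal_isometry_def)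
  define c where "c t = (\<lambda>v. if v \<in> V then flow Z t (p v) + t *\<^sub>R a else 0)" for t :: real
  \<comment> \<open>Derivatives of all orders: each differentiation applies \<open>Z\<close> once
    more inside the flow, while the translation survives only in orders 0 and 1.\<close>
  define D where "D v n t = (if v \<in> V then flow Z t ((Z ^^ n) (p v)) +
    (if n = 0 then t *\<^sub>R a else if n = 1 then a else 0) else 0)" for v n and t :: real
  have D0: "D v 0 = (\<lambda>t. c t v)" for v by (auto simp: D_def c_def)
  have D: "(D v n has_vector_derivative D v (Suc n) t) (at t)" for v n t
  proof (cases "v \<in> V")
    case True
    have f: "((\<lambda>t. flow Z t ((Z ^^ n) (p v))) has_vector_derivative flow Z t ((Z ^^ Suc n) (p v))) (at t)"
      using flow_has_vector_derivative[OF lin] by simp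
    have g: "((\<lambda>t. if n = 0 then t *\<^sub>R a else if n = 1 then a else 0) has_vector_derivative
        (if n = 0 then a else 0)) (at t)"
      using has_vector_derivative_scaleR[OF DERIV_ident has_vector_derivative_const[of a], of t UNIV]
      by (cases "n = 0") auto
    have "D v n = (\<lambda>t. flow Z t ((Z ^^ n) (p v)) + (if n = 0 then t *\<^sub>R a else if n = 1 then a else 0))"
      "D v (Suc n) t = flow Z t ((Z ^^ Suc n) (p v)) + (if n = 0 then a else 0)"
      using True by (auto simp: D_def)
    then show ?thesis using has_vector_derivative_add[OF f g] by simp
  next
    case False
    then have "D v n = (\<lambda>t. 0)" "D v (Suc n) t = 0" by (auto simp: D_def)
    then show ?thesis by simp
  qed
  have "smooth_curve 1 c"
    unfolding smooth_curve_def using D D0 by blast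
  moreover have "c t \<in> congruent_configurations V p" for t
  proof -
    have L: "linear_isometry (flow Z t)" by (rule linear_isometry_flow[OF Z])
    note I = linear_isometry_inv[OF L]
    \<comment> \<open>Congruence asks for an isometry from \<open>c t\<close> back to
      \<open>p\<close>, hence the inverse of the motion.\<close>
    define T where "T y = inv (flow Z t) (y - t *\<^sub>R a)" for y
    have "T y - T z = inv (flow Z t) (y - z)" for y z
      using I linear_diff[of "inv (flow Z t)" "y - t *\<^sub>R a" "z - t *\<^sub>R a"]
      by (simp add: T_def linear_isometry_def)
    then have "isometry T"
      using I by (simp add: isometry_def dist_norm linear_isometry_def)
    moreover have "p v = T (c t v)" if "v \<in> V" for v
      using that linear_isometry_bij[OF L] by (simp add: T_def c_def bij_is_inj)
    ultimately show ?thesis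
      by (auto simp: congruent_configurations_def configurations_def c_def)
  qed
  moreover have "c 0 = p"
    using p by (auto simp: c_def flow_0_time[OF lin] configurations_def)
  moreover have "((\<lambda>t. c t v) has_vector_derivative (if v \<in> V then Z (p v) + a else 0)) (at 0)" for v
  proof -
    have "D v (Suc 0) 0 = (if v \<in> V then Z (p v) + a else 0)"
      by (simp add: D_def flow_0_time[OF lin])
    then show ?thesis using D[of v 0 0] unfolding D0 by (simp only:)
  qed
  ultimately show ?thesis
    unfolding tangent_space_def
    by (intro CollectI exI[of _ "1 :: real"] exI[of _ c] conjI allI ballI) simp_all
qed

text \<open>Subtracting the vertex \<open>v0\<close> removes translations, so the inverses of the
  linear parts of the sampled isometries carry \<open>p v - p v0\<close> to the differences along
  the curve. Their quotients converge because the curve is differentiable, which is all that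
  \<open>infinitesimal_isometry_extension\<close> requires.\<close>

lemma tangent_vector_is_infinitesimal_isometry:
  fixes p :: "'v \<Rightarrow> 'a"
  assumes p: "p \<in> configurations V" and v0: "v0 \<in> V" and u: "u \<in> tangent_space V p"
  shows "\<exists>Z a. infinitesimal_isometry Z \<and> u = (\<lambda>v. if v \<in> V then Z (p v) + a else 0)"
proof -
  obtain r c where r: "r > 0"
    and c: "\<And>t. t \<in> {-r<..<r} \<Longrightarrow> c t \<in> congruent_configurations V p" "c 0 = p"
    and der: "\<And>v. ((\<lambda>t. c t v) has_vector_derivative u v) (at 0)"
    using u unfolding tangent_space_def by blast
  \<comment> \<open>With \<open>n + 2\<close> even the first sample lies strictly inside the
    interval.\<close>
  define t where "t n = r / real (n + 2)" for n :: nat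
  have t: "t n > 0" "t n < r" for n
    using r by (simp_all add: t_def field_simps add_pos_nonneg)
  have t_lim: "t \<longlonglongrightarrow> 0"
    unfolding t_def using LIMSEQ_ignore_initial_segment[OF lim_const_over_n[of r], of 2] by simp
  have t_at: "filterlim t (at 0) sequentially"
    unfolding filterlim_at using t_lim t(1) by (auto intro!: always_eventually simp: less_imp_neq[symmetric])
  have "\<exists>T. isometry T \<and> (\<forall>v\<in>V. p v = T (c (t n) v))" for n
    using c(1)[of "t n"] t[of n] r by (auto simp: congruent_configurations_def)
  then obtain T where T: "\<And>n. isometry (T n)" "\<And>n v. v \<in> V \<Longrightarrow> p v = T n (c (t n) v)"
    by metis
  define S where "S n = (\<lambda>x. T n x - T n 0)" for n
  have S: "linear_isometry (S n)" for n
  proof -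
    have "norm (S n x) = norm x" for x
      using T(1)[of n] unfolding isometry_def S_def by (metis diff_zero dist_norm)
    then show ?thesis
      using isometry_imp_linear[OF T(1)[of n]] by (simp add: linear_isometry_def S_def)
  qed
  have L: "inv (S n) (p v - p v0) = c (t n) v - c (t n) v0" if v: "v \<in> V" for n v
  proof -
    have "S n (c (t n) v - c (t n) v0) = p v - p v0"
      using S[of n] T(2)[OF v, of n] T(2)[OF v0, of n]
      by (simp add: linear_isometry_def linear_diff) (simp add: S_def)
    then show ?thesis using linear_isometry_bij[OF S[of n]] by (metis bij_is_inj inv_f_f)
  qed
  have "(\<lambda>n. (inv (S n) (p v - p v0) - (p v - p v0)) /\<^sub>R t n) \<longlonglongrightarrow> u v - u v0" if v: "v \<in> V" for v
  proof -
    have q: "(\<lambda>n. (c (t n) w - c 0 w) /\<^sub>R (t n - 0)) \<longlonglongrightarrow> u w" for w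
      by (rule filterlim_compose[OF has_vector_derivative_tendsto_quotient[OF der] t_at])
    have "(inv (S n) (p v - p v0) - (p v - p v0)) /\<^sub>R t n =
        (c (t n) v - c 0 v) /\<^sub>R (t n - 0) - (c (t n) v0 - c 0 v0) /\<^sub>R (t n - 0)" for n
      unfolding L[OF v] c(2) by (simp add: scaleR_diff_right)
    then show ?thesis using tendsto_diff[OF q[of v] q[of v0]] by simp
  qed
  note quot = this
  obtain Z where Z: "infinitesimal_isometry Z" and Zw: "\<forall>v\<in>V. Z (p v - p v0) = u v - u v0"
    using infinitesimal_isometry_extension[of "\<lambda>n. inv (S n)" t V "\<lambda>v. p v - p v0" "\<lambda>v. u v - u v0",
        OF linear_isometry_inv[OF S] t(1) t_lim quot] by blast
  have lin: "linear Z" using Z by (simp add: infinitesimal_isometry_def)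
  have "u v = Z (p v) + (u v0 - Z (p v0))" if "v \<in> V" for v
  proof -
    have "Z (p v) + (u v0 - Z (p v0)) = (Z (p v) - Z (p v0)) + u v0" by simp
    also have "\<dots> = u v"
      using bspec[OF Zw that] by (simp add: linear_diff[OF lin])
    finally show ?thesis ..
  qed
  moreover have "u v = 0" if v: "v \<notin> V" for v
  proof -
    have "((\<lambda>t. c t v) has_vector_derivative 0) (at 0)"
    proof (rule has_vector_derivative_transform_within_open[of "\<lambda>_. 0"])
      show "open {-r<..<r}" "0 \<in> {-r<..<r}" using r by auto
      show "0 = c x v" if "x \<in> {-r<..<r}" for x
        using c(1)[OF that] v by (simp add: congruent_configurations_def configurations_def)
    qed simp
    then show ?thesis using der[of v] vector_derivative_unique_at by blast
  qed
  ultimately have "u = (\<lambda>v. if v \<in> V then Z (p v) + (u v0 - Z (p v0)) else 0)" by auto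
  then show ?thesis using Z by blast
qed

section \<open>Dimension of the tangent space\<close>

definition infinitesimal_motions :: "(('a \<Rightarrow> 'a) \<times> 'a) set" where
  "infinitesimal_motions = {(Z, a). infinitesimal_isometry Z}"

definition motion_on :: "'v set \<Rightarrow> ('v \<Rightarrow> 'a) \<Rightarrow> ('a \<Rightarrow> 'a) \<times> 'a \<Rightarrow> 'v \<Rightarrow> 'a" where
  "motion_on V p = (\<lambda>(Z, a) v. if v \<in> V then Z (p v) + a else 0)"

text \<open>Exhibits the set of velocities as a linear image of one space that depends on neither
  \<open>V\<close> nor \<open>p\<close>; this is what makes tangent spaces of different graphs
  comparable.\<close>

lemma tangent_space_eq:
  assumes "p \<in> configurations V" "V \<noteq> {}"
  shows "tangent_space V p = motion_on V p ` infinitesimal_motions"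
proof
  obtain v0 where "v0 \<in> V" using assms(2) by blast
  then show "tangent_space V p \<subseteq> motion_on V p ` infinitesimal_motions"
    using tangent_vector_is_infinitesimal_isometry[OF assms(1)]
    by (fastforce simp: motion_on_def infinitesimal_motions_def image_iff)
  show "motion_on V p ` infinitesimal_motions \<subseteq> tangent_space V p"
    using flow_curve_in_tangent_space[OF assms(1)]
    by (auto simp: motion_on_def infinitesimal_motions_def)
qed

lemma linear_motion_on: "linear (motion_on V p)"
  by (rule linearI)
    (auto simp: motion_on_def fun_eq_iff scaleR_fun_def scaleR_add_right split: prod.splits)

lemma subspace_infinitesimal_motions: "subspace infinitesimal_motions"
  unfolding subspace_def infinitesimal_motions_def infinitesimal_isometry_def zero_prod_def
  by (auto simp: linear_iff linear_0[OF linear_phi] linear_add[OF linear_phi] linear_scale[OF linear_phi]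
      scaleR_fun_def algebra_simps)

text \<open>The ambient type of functions may be infinite-dimensional, but a motion is determined by
  finitely many coordinates. Without this, \<open>dim\<close> could be the default value 0.\<close>

lemma infinitesimal_motions_finite_basis:
  obtains B where "finite B" "infinitesimal_motions \<subseteq> span B"
proof -
  obtain B where B: "B \<subseteq> infinitesimal_motions" "independent B" "infinitesimal_motions \<subseteq> span B"
    by (rule basis_exists[of infinitesimal_motions])
  \<comment> \<open>First index 0 holds the coordinates of the translation, first index
    \<open>i\<close> \<ge> 1 those of the image of \<open>b i\<close>.\<close>
  define g :: "('a \<Rightarrow> 'a) \<times> 'a \<Rightarrow> nat \<times> nat \<Rightarrow> real" where
    "g = (\<lambda>x (i, k). if k \<in> {1..d} \<and> i \<le> d then coord k (if i = 0 then snd x else fst x (b i)) else 0)"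
  have g: "linear g"
    by (rule linearI)
      (auto simp: g_def fun_eq_iff scaleR_fun_def linear_add[OF linear_coord] linear_scale[OF linear_coord])
  have "inj_on g infinitesimal_motions"
    unfolding linear_inj_on_iff_eq_0[OF g subspace_infinitesimal_motions]
  proof (intro ballI impI)
    fix x assume x: "x \<in> infinitesimal_motions" "g x = 0"
    obtain Z a where Za: "x = (Z, a)" by fastforce
    have z: "coord k (if i = 0 then a else Z (b i)) = 0" if "k \<in> {1..d}" "i \<le> d" for i k
      using fun_cong[OF x(2), of "(i, k)"] that by (cases "i = 0") (simp_all add: g_def Za)
    have "a = 0"
      by (rule eq_if_coord_eq) (use z[of _ 0] in \<open>simp add: coord_0\<close>)
    moreover have "Z (b i) = 0" if "i \<in> {1..d}" for i
      by (rule eq_if_coord_eq) (use z[of _ i] that in \<open>simp add: coord_0\<close>)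
    then have "Z = (\<lambda>_. 0)"
      using x(1) by (intro linear_eqI)
        (auto simp: Za infinitesimal_motions_def infinitesimal_isometry_def linear_zero)
    ultimately show "x = 0" by (simp add: Za zero_prod_def zero_fun_def)
  qed
  then have inj: "inj_on g (span B)"
    by (rule inj_on_subset) (rule span_minimal[OF B(1) subspace_infinitesimal_motions])
  have ind: "independent (g ` B)"
    by (rule linear_independent_injective_image[OF g B(2) inj])
  have "f i = 0" if "f \<in> g ` B" "i \<notin> {0..d} \<times> {1..d}" for f i
    using that by (cases i) (auto simp: g_def)
  note supp = this
  have "finite (g ` B) \<and> card (g ` B) \<le> card ({0..d} \<times> {1..d})"
    by (rule independent_finite_support_card[OF _ ind]) (simp, rule supp)
  then have "finite B"
    using finite_imageD inj_on_subset[OF inj span_superset] by blast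
  then show ?thesis using that B(3) by blast
qed

lemma dim_tangent_space_le:
  fixes p :: "'v \<Rightarrow> 'a"
  assumes "p \<in> configurations V" "V \<noteq> {}"
  shows "dim (tangent_space V p) \<le> dim infinitesimal_motions"
proof -
  obtain B where "finite B" "infinitesimal_motions \<subseteq> span B"
    by (rule infinitesimal_motions_finite_basis)
  then show ?thesis
    unfolding tangent_space_eq[OF assms] by (rule dim_linear_image_le[OF linear_motion_on])
qed

text \<open>For nonempty \<open>V\<close> this says that the affine hull of the points is the whole
  space. The form by affine maps is exactly what injectivity of \<open>motion_on\<close>
  needs.\<close>

definition affinely_spanning :: "'v set \<Rightarrow> ('v \<Rightarrow> 'a) \<Rightarrow> bool" where
  "affinely_spanning V p \<longleftrightarrow>
    (\<forall>Z a. linear (Z :: 'a \<Rightarrow> 'a) \<longrightarrow> (\<forall>v\<in>V. Z (p v) + a = 0) \<longrightarrow> Z = (\<lambda>_. 0))"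

lemma dim_tangent_space_affinely_spanning:
  assumes "p \<in> configurations V" "V \<noteq> {}" "affinely_spanning V p"
  shows "dim (tangent_space V p) = dim infinitesimal_motions"
  unfolding tangent_space_eq[OF assms(1,2)]
proof (rule dim_linear_image_eq[OF linear_motion_on subspace_infinitesimal_motions])
  fix x assume x: "x \<in> infinitesimal_motions" "motion_on V p x = 0"
  obtain Z a where Za: "x = (Z, a)" by fastforce
  have eq: "Z (p v) + a = 0" if "v \<in> V" for v
    using fun_cong[OF x(2), of v] that by (simp add: motion_on_def Za)
  have "linear Z" using x(1) by (simp add: Za infinitesimal_motions_def infinitesimal_isometry_def)
  then have "Z = (\<lambda>_. 0)" using assms(3) eq unfolding affinely_spanning_def by blast
  moreover have "a = 0" using eq assms(2) \<open>Z = (\<lambda>_. 0)\<close> by auto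
  ultimately show "x = 0" by (simp add: Za zero_prod_def zero_fun_def)
qed

end

section \<open>Stresses, rank and rigidity\<close>

lemma independent_family_iff:
  fixes f :: "'i \<Rightarrow> 'c::real_vector"
  assumes "finite I"
  shows "inj_on f I \<and> independent (f ` I) \<longleftrightarrow>
    (\<forall>c. (\<Sum>i\<in>I. c i *\<^sub>R f i) = 0 \<longrightarrow> (\<forall>i\<in>I. c i = 0))"
proof
  assume L: "inj_on f I \<and> independent (f ` I)"
  show "\<forall>c. (\<Sum>i\<in>I. c i *\<^sub>R f i) = 0 \<longrightarrow> (\<forall>i\<in>I. c i = 0)"
  proof (intro allI impI ballI)
    fix c i assume c: "(\<Sum>i\<in>I. c i *\<^sub>R f i) = 0" and i: "i \<in> I"
    have "(\<Sum>y\<in>f ` I. c (the_inv_into I f y) *\<^sub>R y) = (\<Sum>i\<in>I. c i *\<^sub>R f i)"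
      using L by (simp add: sum.reindex the_inv_into_f_f)
    then have "c (the_inv_into I f (f i)) = 0"
      using L assms i c by (intro independentD[of "f ` I" "f ` I" "\<lambda>y. c (the_inv_into I f y)"]) auto
    then show "c i = 0" using L i by (simp add: the_inv_into_f_f)
  qed
next
  assume R: "\<forall>c. (\<Sum>i\<in>I. c i *\<^sub>R f i) = 0 \<longrightarrow> (\<forall>i\<in>I. c i = 0)"
  have inj: "inj_on f I"
  proof (rule inj_onI, rule ccontr)
    fix i j assume ij: "i \<in> I" "j \<in> I" "f i = f j" "i \<noteq> j"
    define c :: "'i \<Rightarrow> real" where "c k = (if k = i then 1 else if k = j then -1 else 0)" for k
    have "(\<Sum>k\<in>I. c k *\<^sub>R f k) = (\<Sum>k\<in>{i, j}. c k *\<^sub>R f k)"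
      by (rule sum.mono_neutral_right) (use assms ij in \<open>auto simp: c_def\<close>)
    also have "\<dots> = 0" using ij by (simp add: c_def)
    finally have "c i = 0" using R ij by blast
    then show False by (simp add: c_def)
  qed
  moreover have "independent (f ` I)"
  proof (rule independent_if_scalars_zero)
    fix c y assume c: "(\<Sum>y\<in>f ` I. c y *\<^sub>R y) = 0" and y: "y \<in> f ` I"
    have "(\<Sum>i\<in>I. c (f i) *\<^sub>R f i) = 0"
      using c inj by (simp add: sum.reindex)
    then show "c y = 0" using R[rule_format, of "\<lambda>i. c (f i)"] y by blast
  qed (use assms in simp)
  ultimately show "inj_on f I \<and> independent (f ` I)" by blast
qed

lemma sum_fun_apply: "(\<Sum>i\<in>I. f i) x = (\<Sum>i\<in>I. f i x)"
  for f :: "'i \<Rightarrow> 'x \<Rightarrow> 'c::ab_group_add"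
  by (induction I rule: infinite_finite_induct) auto

text \<open>On functions supported in \<open>I\<close> the pairing is an inner product, so the
  orthogonal spans of \<open>A\<close> and \<open>B\<close> meet only in 0. Adding the elements of
  \<open>B\<close> to \<open>A\<close> one at a time therefore keeps independence.\<close>

lemma orthogonal_independent_card:
  fixes A B :: "('i \<Rightarrow> real) set"
  assumes I: "finite I" and A: "independent A" and B: "independent B"
    and supp: "\<And>f i. f \<in> A \<union> B \<Longrightarrow> i \<notin> I \<Longrightarrow> f i = 0"
    and orth: "\<And>f g. f \<in> A \<Longrightarrow> g \<in> B \<Longrightarrow> (\<Sum>i\<in>I. f i * g i) = 0"
  shows "card A + card B \<le> card I"
proof -
  have fin: "finite A" "finite B"
    using independent_finite_support_card[OF I A] independent_finite_support_card[OF I B] supp by blast+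
  have sub: "subspace {f. \<forall>g\<in>B. (\<Sum>i\<in>I. f i * g i) = 0}"
    by (auto simp: subspace_def scaleR_fun_def distrib_right sum.distrib mult.assoc simp flip: sum_distrib_left)
  have orth1: "(\<Sum>i\<in>I. f i * g i) = 0" if "f \<in> span A" "g \<in> B" for f g
    using span_minimal[OF _ sub, of A] orth that by blast
  have sub2: "subspace {g. (\<Sum>i\<in>I. f i * g i) = 0}" for f :: "'i \<Rightarrow> real"
    by (auto simp: subspace_def scaleR_fun_def distrib_left sum.distrib mult.left_commute simp flip: sum_distrib_left)
  have orth2: "(\<Sum>i\<in>I. f i * g i) = 0" if "f \<in> span A" "g \<in> span B" for f g
    using span_minimal[OF _ sub2, of B f] orth1 that by blast
  have sub3: "subspace {f :: 'i \<Rightarrow> real. \<forall>i. i \<notin> I \<longrightarrow> f i = 0}"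
    by (auto simp: subspace_def scaleR_fun_def)
  have supp_span: "f i = 0" if "f \<in> span A" "i \<notin> I" for f i
    using span_minimal[OF _ sub3, of A] supp that by blast
  have zero: "f = 0" if "f \<in> span A" "f \<in> span B" for f
  proof
    fix i
    have "\<forall>i\<in>I. f i * f i = 0"
      using orth2[OF that] I by (subst (asm) sum_nonneg_eq_0_iff) auto
    then show "f i = 0 i" using supp_span[OF that(1)] by (cases "i \<in> I") auto
  qed
  have "independent (A \<union> B') \<and> A \<inter> B' = {}" if "B' \<subseteq> B" for B'
  proof -
    have "finite B'" using that fin finite_subset by blast
    then show ?thesis using that
    proof (induction B' rule: finite_induct)
      case empty
      then show ?case using A by simp
    next
      case (insert x B')
      have x: "x \<notin> span (A \<union> B')"
      proof
        assume "x \<in> span (A \<union> B')"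
        then obtain y z where yz: "x = y + z" "y \<in> span A" "z \<in> span B'"
          by (auto simp: span_Un)
        have "z \<in> span B" using yz(3) insert.prems span_mono[of B' B] by blast
        moreover have "x \<in> span B" using insert.prems by (simp add: span_base)
        ultimately have "y \<in> span B" using yz(1) span_diff[of x B z] by simp
        then have "x = z" using zero yz by simp
        then have "x \<in> span (B - {x})"
          using yz(3) insert span_mono[of B' "B - {x}"] by blast
        then show False using B insert.prems by (auto simp: dependent_def)
      qed
      then have "x \<notin> A" using span_base by blast
      moreover have "independent (insert x (A \<union> B'))"
        using insert x by (intro independent_insertI) auto
      ultimately show ?case using insert by simp
    qed
  qed
  from this[of B] have ind: "independent (A \<union> B)" and disj: "A \<inter> B = {}" by auto
  have "card (A \<union> B) \<le> card I"
    using independent_finite_support_card[OF I ind] supp by blast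
  then show ?thesis using fin disj by (simp add: card_Un_disjoint)
qed

section \<open>The rigidity matrix as functionals on velocity fields\<close>

context smooth_strictly_convex_space
begin

text \<open>The row of \<open>e\<close> without coordinates, acting on a velocity field
  \<open>u\<close>. For an edge vw it is \<phi> (p v - p w) applied to u v - u w.\<close>

definition edge_functional :: "('v \<Rightarrow> 'a) \<Rightarrow> 'v set \<Rightarrow> ('v \<Rightarrow> 'a) \<Rightarrow> real" where
  "edge_functional p e u = (\<Sum>v\<in>e. \<phi> (p v - p (THE w. e = {v, w})) (u v))"

lemma edge_functional_pair:
  assumes "v \<noteq> w"
  shows "edge_functional p {v, w} u = \<phi> (p v - p w) (u v - u w)"
proof -
  have the: "(THE z. {v, w} = {v, z}) = w" "(THE z. {v, w} = {w, z}) = v"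
    using assms by (auto simp: doubleton_eq_iff intro!: the_equality)
  show ?thesis
    using assms by (simp add: edge_functional_def the linear_diff[OF linear_phi] phi_diff_commute[of "p w" "p v"])
qed

lemma simple_graph_finite: "simple_graph V E \<Longrightarrow> finite E"
  by (rule finite_subset[of E "Pow V"]) (auto simp: simple_graph_def)

lemma simple_graph_edgeE:
  assumes "simple_graph V E" "e \<in> E"
  obtains v w where "e = {v, w}" "v \<noteq> w" "v \<in> V" "w \<in> V"
proof -
  have "card e = 2" "e \<subseteq> V" using assms by (auto simp: simple_graph_def)
  then show ?thesis using that by (auto simp: card_2_iff)
qed

lemma rigidity_matrix_entry:
  assumes "finite e" "k \<in> {1..d}"
  shows "rigidity_matrix b p e (v, k) = edge_functional p e (\<lambda>x. if x = v then b k else 0)"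
proof -
  have "edge_functional p e (\<lambda>x. if x = v then b k else 0) =
      (\<Sum>x\<in>e. if x = v then \<phi> (p v - p (THE w. e = {v, w})) (b k) else 0)"
    unfolding edge_functional_def by (rule sum.cong) (auto simp: linear_0[OF linear_phi])
  then show ?thesis using assms by (simp add: rigidity_matrix_def dim_UNIV)
qed

lemma edge_functional_eq_sum:
  assumes "finite V" "e \<subseteq> V"
  shows "edge_functional p e u = (\<Sum>(v, k)\<in>V \<times> {1..d}. rigidity_matrix b p e (v, k) * coord k (u v))"
proof -
  have "(\<Sum>(v, k)\<in>V \<times> {1..d}. rigidity_matrix b p e (v, k) * coord k (u v)) =
      (\<Sum>v\<in>V. \<Sum>k\<in>{1..d}. rigidity_matrix b p e (v, k) * coord k (u v))"
    by (rule sum.cartesian_product[symmetric])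
  also have "\<dots> = (\<Sum>v\<in>V. if v \<in> e then \<phi> (p v - p (THE w. e = {v, w})) (u v) else 0)"
  proof (rule sum.cong[OF refl])
    fix v assume "v \<in> V"
    have "(\<Sum>k\<in>{1..d}. coord k (u v) *\<^sub>R f (b k)) = f (u v)" if "linear f" for f :: "'a \<Rightarrow> real"
      by (rule linear_expand[OF that, symmetric])
    from this[OF linear_phi[of "p v - p (THE w. e = {v, w})"]]
    show "(\<Sum>k\<in>{1..d}. rigidity_matrix b p e (v, k) * coord k (u v)) =
        (if v \<in> e then \<phi> (p v - p (THE w. e = {v, w})) (u v) else 0)"
      by (simp add: rigidity_matrix_def dim_UNIV mult.commute)
  qed
  also have "\<dots> = (\<Sum>v\<in>e. \<phi> (p v - p (THE w. e = {v, w})) (u v))"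
    using assms by (simp add: sum.If_cases Int_absorb1 Int_def[symmetric])
  finally show ?thesis by (simp add: edge_functional_def)
qed

lemma rigidity_matrix_support:
  assumes "e \<subseteq> V" "z \<notin> V \<times> {1..d}"
  shows "rigidity_matrix b p e z = 0"
  using assms by (auto simp: rigidity_matrix_def dim_UNIV split: prod.splits)

text \<open>Pairing the rows with the coordinates of \<open>u\<close> gives one direction; fields
  with the value \<open>b k\<close> at a single vertex recover the entries and give the
  other.\<close>

lemma rigidity_matrix_sum_eq_0_iff:
  fixes p :: "'v \<Rightarrow> 'a"
  assumes G: "simple_graph V E"
  shows "(\<Sum>e\<in>E. c e *\<^sub>R rigidity_matrix b p e) = 0 \<longleftrightarrow> (\<forall>u. (\<Sum>e\<in>E. c e * edge_functional p e u) = 0)"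
proof
  have V: "finite V" "\<And>e. e \<in> E \<Longrightarrow> e \<subseteq> V" "\<And>e. e \<in> E \<Longrightarrow> finite e"
    using G by (auto simp: simple_graph_def intro: finite_subset)
  have app: "(\<Sum>e\<in>E. c e *\<^sub>R rigidity_matrix b p e) z = (\<Sum>e\<in>E. c e * rigidity_matrix b p e z)" for z :: "'v \<times> nat"
    by (simp add: sum_fun_apply scaleR_fun_def)
  {
    assume L: "(\<Sum>e\<in>E. c e *\<^sub>R rigidity_matrix b p e) = 0"
    show "\<forall>u. (\<Sum>e\<in>E. c e * edge_functional p e u) = 0"
    proof
      fix u :: "'v \<Rightarrow> 'a"
      have "(\<Sum>e\<in>E. c e * edge_functional p e u) =
          (\<Sum>e\<in>E. \<Sum>z\<in>V \<times> {1..d}. c e * rigidity_matrix b p e z * coord (snd z) (u (fst z)))"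
        by (rule sum.cong) (simp_all add: edge_functional_eq_sum[OF V(1,2)] sum_distrib_left
            case_prod_unfold mult.assoc)
      also have "\<dots> = (\<Sum>z\<in>V \<times> {1..d}. (\<Sum>e\<in>E. c e * rigidity_matrix b p e z) * coord (snd z) (u (fst z)))"
        by (subst sum.swap) (simp add: sum_distrib_right)
      also have "\<dots> = 0"
        using L by (simp flip: app)
      finally show "(\<Sum>e\<in>E. c e * edge_functional p e u) = 0" .
    qed
  }
  assume R: "\<forall>u. (\<Sum>e\<in>E. c e * edge_functional p e u) = 0"
  show "(\<Sum>e\<in>E. c e *\<^sub>R rigidity_matrix b p e) = 0"
  proof
    fix z :: "'v \<times> nat"
    obtain v k where z: "z = (v, k)" by fastforce
    have "(\<Sum>e\<in>E. c e * rigidity_matrix b p e z) = 0"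
    proof (cases "k \<in> {1..d}")
      case True
      have "(\<Sum>e\<in>E. c e * rigidity_matrix b p e z) =
          (\<Sum>e\<in>E. c e * edge_functional p e (\<lambda>x. if x = v then b k else 0))"
        by (rule sum.cong) (simp_all add: z rigidity_matrix_entry[OF V(3) True])
      then show ?thesis using R by simp
    next
      case False
      then show ?thesis
        by (intro sum.neutral) (auto simp: z rigidity_matrix_def dim_UNIV)
    qed
    then show "(\<Sum>e\<in>E. c e *\<^sub>R rigidity_matrix b p e) z = 0 z" by (simp add: app)
  qed
qed

text \<open>Coefficients are indexed by edges, not by rows, so distinctness of the rows is
  included.\<close>

definition stress_free :: "'v set set \<Rightarrow> ('v \<Rightarrow> 'a) \<Rightarrow> bool" where
  "stress_free E p \<longleftrightarrow>
    (\<forall>c. (\<forall>u. (\<Sum>e\<in>E. c e * edge_functional p e u) = 0) \<longrightarrow> (\<forall>e\<in>E. c e = 0))"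

lemma independent_framework_iff:
  assumes "simple_graph V E"
  shows "independent_framework b V E p \<longleftrightarrow> placement V E p \<and> stress_free E p"
  using independent_family_iff[OF simple_graph_finite[OF assms], of "rigidity_matrix b p"]
  by (auto simp: independent_framework_def stress_free_def rigidity_matrix_sum_eq_0_iff[OF assms]
      well_positioned_def smooth_point_iff placement_def)

text \<open>A tangent vector has differences \<open>Z (p v - p w)\<close> along edges, and these are
  annihilated by the edge functionals. Rows and tangent vectors are thus orthogonal in a space with
  \<open>d * card V\<close> coordinates.\<close>

lemma independent_framework_card_le:
  fixes p :: "'v \<Rightarrow> 'a"
  assumes G: "simple_graph V E" and ne: "V \<noteq> {}" and ind: "independent_framework b V E p"
  shows "card E + dim (tangent_space V p) \<le> d * card V"
proof -
  have V: "finite V" "\<And>e. e \<in> E \<Longrightarrow> e \<subseteq> V" using G by (auto simp: simple_graph_def)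
  have p: "p \<in> configurations V"
    using ind by (simp add: independent_framework_def well_positioned_def placement_def)
  let ?R = "rigidity_matrix b p ` E"
  have R: "independent ?R" "card ?R = card E"
    using ind by (auto simp: independent_framework_def card_image)
  obtain U where U: "U \<subseteq> tangent_space V p" "independent U" "card U = dim (tangent_space V p)"
    by (rule basis_exists[of "tangent_space V p"])
  define g :: "('v \<Rightarrow> 'a) \<Rightarrow> 'v \<times> nat \<Rightarrow> real" where
    "g u = (\<lambda>(v, k). if v \<in> V \<and> k \<in> {1..d} then coord k (u v) else 0)" for u
  have g: "linear g"
    by (rule linearI)
      (auto simp: g_def fun_eq_iff scaleR_fun_def linear_add[OF linear_coord] linear_scale[OF linear_coord])
  have sub: "subspace (configurations V :: ('v \<Rightarrow> 'a) set)"
    by (auto simp: subspace_def configurations_def scaleR_fun_def)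
  have Uconf: "U \<subseteq> configurations V"
    using U(1) unfolding tangent_space_eq[OF p ne]
    by (auto simp: motion_on_def configurations_def)
  have "inj_on g (configurations V)"
    unfolding linear_inj_on_iff_eq_0[OF g sub]
  proof (intro ballI impI)
    fix u :: "'v \<Rightarrow> 'a" assume u: "u \<in> configurations V" "g u = 0"
    have "coord k (u v) = 0" if "v \<in> V" "k \<in> {1..d}" for v k
      using fun_cong[OF u(2), of "(v, k)"] that by (simp add: g_def)
    then have "u v = 0" if "v \<in> V" for v
      using that by (intro eq_if_coord_eq) (simp add: coord_0)
    then show "u = 0" using u(1) by (auto simp: configurations_def fun_eq_iff)
  qed
  then have inj: "inj_on g (span U)"
    by (rule inj_on_subset) (rule span_minimal[OF Uconf sub])
  have gU: "independent (g ` U)" "card (g ` U) = card U"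
    using linear_independent_injective_image[OF g U(2) inj] card_image[OF inj_on_subset[OF inj span_superset]]
    by auto
  have "card ?R + card (g ` U) \<le> card (V \<times> {1..d})"
  proof (rule orthogonal_independent_card[OF _ R(1) gU(1)])
    show "finite (V \<times> {1..d})" using V by simp
    show "f z = 0" if f: "f \<in> ?R \<union> g ` U" and z: "z \<notin> V \<times> {1..d}" for f z
    proof -
      have "g u z = 0" for u using z by (cases z) (auto simp: g_def)
      then show ?thesis using f rigidity_matrix_support[OF V(2) z] by blast
    qed
    show "(\<Sum>z\<in>V \<times> {1..d}. f z * h z) = 0" if f: "f \<in> ?R" and h: "h \<in> g ` U" for f h
    proof -
      obtain e where e: "e \<in> E" "f = rigidity_matrix b p e" using f by blast
      obtain u where u: "u \<in> U" "h = g u" using h by blast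
      obtain Z a where Z: "infinitesimal_isometry Z" and uZ: "u = motion_on V p (Z, a)"
        using U(1) u(1) unfolding tangent_space_eq[OF p ne]
        by (auto simp: infinitesimal_motions_def)
      obtain v w where vw: "e = {v, w}" "v \<noteq> w" "v \<in> V" "w \<in> V"
        using simple_graph_edgeE[OF G e(1)] by blast
      have "(\<Sum>z\<in>V \<times> {1..d}. f z * h z) = edge_functional p e u"
        unfolding edge_functional_eq_sum[OF V(1) V(2)[OF e(1)]]
        by (rule sum.cong) (auto simp: e(2) u(2) g_def)
      also have "\<dots> = \<phi> (p v - p w) (u v - u w)"
        unfolding vw(1) by (rule edge_functional_pair[OF vw(2)])
      also have "u v - u w = Z (p v - p w)"
        using vw Z by (simp add: uZ motion_on_def infinitesimal_isometry_def linear_diff)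
      also have "\<phi> (p v - p w) (Z (p v - p w)) = 0"
        using Z by (simp add: infinitesimal_isometry_def)
      finally show ?thesis .
    qed
  qed
  then show ?thesis using R(2) gU(2) U(3) by (simp add: card_cartesian_product mult.commute)
qed

lemma rigidity_rank_independent:
  "independent_framework b V E p \<Longrightarrow> rigidity_rank b E p = card E"
  by (simp add: independent_framework_def rigidity_rank_def dim_eq_card_independent card_image)

lemma rigidity_rank_le:
  fixes p :: "'v \<Rightarrow> 'a"
  assumes "finite E" shows "rigidity_rank b E p \<le> card E"
proof -
  have "dim (rigidity_matrix b p ` E) \<le> card (rigidity_matrix b p ` E)"
    using assms by (intro dim_le_card span_superset) auto
  then show ?thesis using card_image_le[OF assms, of "rigidity_matrix b p"] by (simp add: rigidity_rank_def)
qed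

text \<open>A placement witnessing rigidity need not be affinely spanning; its tangent space is then
  still no larger than that of \<open>q\<close>, which suffices.\<close>

lemma rigid_graph_iff_card:
  fixes q :: "'v \<Rightarrow> 'a"
  assumes G: "simple_graph V E" and ne: "V \<noteq> {}"
    and q: "independent_framework b V E q" "affinely_spanning V q"
  shows "rigid_graph b V E \<longleftrightarrow> card E + dim infinitesimal_motions = d * card V"
proof -
  have finE: "finite E" by (rule simple_graph_finite[OF G])
  have wq: "well_positioned V E q" "q \<in> configurations V"
    using q(1) by (auto simp: independent_framework_def well_positioned_def placement_def)
  have dimq: "dim (tangent_space V q) = dim infinitesimal_motions"
    by (rule dim_tangent_space_affinely_spanning[OF wq(2) ne q(2)])
  have regq: "regular_framework b V E q"
    using wq rigidity_rank_le[OF finE] by (simp add: regular_framework_def rigidity_rank_independent[OF q(1)])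
  have le: "card E + dim infinitesimal_motions \<le> d * card V"
    using independent_framework_card_le[OF G ne q(1)] by (simp add: dimq)
  show ?thesis
  proof
    assume "rigid_graph b V E"
    then obtain p where reg: "regular_framework b V E p"
      and rank: "int (rigidity_rank b E p) = int (d * card V) - int (dim (tangent_space V p))"
      by (auto simp: rigid_graph_def rigid_framework_def dim_UNIV)
    have wp: "p \<in> configurations V"
      using reg by (simp add: regular_framework_def well_positioned_def placement_def)
    have "rigidity_rank b E q \<le> rigidity_rank b E p"
      using reg wq(1) by (simp add: regular_framework_def)
    \<comment> \<open>Regularity of \<open>p\<close> is played against \<open>q\<close>, whose rank
      is already the number of edges.\<close>
    then have "rigidity_rank b E p = card E"
      using rigidity_rank_le[OF finE, of p] by (simp add: rigidity_rank_independent[OF q(1)])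
    moreover have "dim (tangent_space V p) \<le> dim infinitesimal_motions"
      by (rule dim_tangent_space_le[OF wp ne])
    ultimately show "card E + dim infinitesimal_motions = d * card V"
      using rank le by linarith
  next
    assume "card E + dim infinitesimal_motions = d * card V"
    then have "int (d * card V) = int (card E) + int (dim infinitesimal_motions)"
      by (metis of_nat_add)
    then have "rigid_framework b V E q"
      using regq unfolding rigid_framework_def dimq rigidity_rank_independent[OF q(1)] dim_UNIV by simp
    then show "rigid_graph b V E" by (auto simp: rigid_graph_def)
  qed
qed

end

section \<open>Openness of independence and generic perturbations\<close>

lemma independent_sequence:
  fixes f :: "nat \<Rightarrow> 'c::real_vector"
  assumes "\<And>i. i \<in> {1..m} \<Longrightarrow> f i \<notin> span (f ` {1..<i})"
  shows "inj_on f {1..m} \<and> independent (f ` {1..m})"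
  using assms
proof (induction m)
  case (Suc m)
  have IH: "inj_on f {1..m}" "independent (f ` {1..m})"
    using Suc.IH Suc.prems by auto
  have "{1..<Suc m} = {1..m}" by auto
  then have new: "f (Suc m) \<notin> span (f ` {1..m})"
    using Suc.prems[of "Suc m"] by simp
  then have "f (Suc m) \<notin> f ` {1..m}" by (metis span_base)
  moreover have "{1..Suc m} = insert (Suc m) {1..m}" by auto
  ultimately show ?case
    using IH independent_insertI[OF new IH(2)] by simp
qed (simp add: independent_empty)

context based_space
begin

text \<open>Otherwise evaluation at the members of \<open>S\<close> would embed a
  \<open>d\<close>-dimensional space into functions supported on fewer than \<open>d\<close>
  points.\<close>

lemma ex_common_zero:
  fixes S :: "('a \<Rightarrow> real) set"
  assumes "finite S" "card S < d" "\<And>f. f \<in> S \<Longrightarrow> linear f"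
  shows "\<exists>y\<noteq>0. \<forall>f\<in>S. f y = 0"
proof (rule ccontr)
  assume no: "\<not> ?thesis"
  define g :: "'a \<Rightarrow> ('a \<Rightarrow> real) \<Rightarrow> real" where "g y = (\<lambda>f. if f \<in> S then f y else 0)" for y
  have g: "linear g"
    by (rule linearI)
      (auto simp: g_def fun_eq_iff scaleR_fun_def linear_add[OF assms(3)] linear_scale[OF assms(3)])
  have "y = 0" if "g y = 0" for y
  proof -
    have "f y = 0" if "f \<in> S" for f
      using fun_cong[OF \<open>g y = 0\<close>, of f] that by (simp add: g_def)
    then show ?thesis using no by blast
  qed
  then have "inj g" unfolding linear_injective_0[OF g] by blast
  have inj: "inj_on g A" for A using \<open>inj g\<close> by (rule inj_on_subset) simp
  have "independent (g ` b ` {1..d})"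
    by (rule linear_independent_injective_image[OF g basis_facts(2) inj])
  then have "finite (g ` b ` {1..d}) \<and> card (g ` b ` {1..d}) \<le> card S"
    by (rule independent_finite_support_card[OF assms(1)]) (auto simp: g_def)
  then show False
    using assms(2) card_image[OF inj, of "b ` {1..d}"] card_basis by simp
qed

text \<open>Greedy choice: before each step fewer than \<open>d\<close> vectors have been fixed, so
  \<open>escape\<close> applies to their span. The map \<Phi> is kept abstract because it is the
  identity when an affinely spanning placement is sought and the duality map when the new vertex is
  placed.\<close>

lemma perturbation_outside_spans:
  fixes \<Phi> :: "'a \<Rightarrow> 'c::real_vector"
  assumes escape: "\<And>S x e. finite S \<Longrightarrow> card S < d \<Longrightarrow> S \<subseteq> range \<Phi> \<Longrightarrow> e > 0 \<Longrightarrow>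
      \<exists>x'. norm (x' - x) < e \<and> \<Phi> x' \<notin> span S"
    and "e > (0::real)" "m \<le> d"
  shows "\<exists>x'. \<forall>i\<in>{1..m}. norm (x' i - x i) < e \<and> \<Phi> (x' i) \<notin> span ((\<lambda>i. \<Phi> (x' i)) ` {1..<i})"
  using assms(3)
proof (induction m)
  case (Suc m)
  then obtain x' where
    x': "\<forall>i\<in>{1..m}. norm (x' i - x i) < e \<and> \<Phi> (x' i) \<notin> span ((\<lambda>i. \<Phi> (x' i)) ` {1..<i})"
    by auto
  let ?S = "(\<lambda>i. \<Phi> (x' i)) ` {1..m}"
  have "card ?S < d"
    using card_image_le[of "{1..m}" "\<lambda>i. \<Phi> (x' i)"] Suc.prems by simp
  then obtain z where z: "norm (z - x (Suc m)) < e" "\<Phi> z \<notin> span ?S"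
    using escape[of ?S e "x (Suc m)"] assms(2) by auto
  define y where "y = x'(Suc m := z)"
  have im: "(\<lambda>i. \<Phi> (y i)) ` {1..<i} = (\<lambda>i. \<Phi> (x' i)) ` {1..<i}" if "i \<le> Suc m" for i
    by (rule image_cong) (use that in \<open>auto simp: y_def\<close>)
  have "norm (y i - x i) < e \<and> \<Phi> (y i) \<notin> span ((\<lambda>i. \<Phi> (y i)) ` {1..<i})" if "i \<in> {1..Suc m}" for i
  proof (cases "i = Suc m")
    case True
    have "{1..<Suc m} = {1..m}" by auto
    then show ?thesis using z True im[of i] by (simp add: y_def)
  next
    case False
    then have "i \<in> {1..m}" "i \<le> Suc m" using that by auto
    then show ?thesis using bspec[OF x', of i] False im[of i] by (simp add: y_def)
  qed
  then show ?case by blast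
qed simp

lemma vector_outside_span:
  fixes S :: "'a set"
  assumes "finite S" "card S < d" "e > 0"
  shows "\<exists>x'. norm (x' - x) < e \<and> x' \<notin> span S"
proof (cases "x \<in> span S")
  case True
  have "span S \<noteq> UNIV"
    using dim_le_card[of UNIV S] assms dim_UNIV by auto
  then obtain w where w: "w \<notin> span S" by blast
  then have "w \<noteq> 0" using span_zero by metis
  define s where "s = e / (2 * norm w)"
  have s: "s > 0" "norm (s *\<^sub>R w) < e"
    using \<open>w \<noteq> 0\<close> assms(3) by (simp_all add: s_def)
  have "x + s *\<^sub>R w \<notin> span S"
  proof
    assume "x + s *\<^sub>R w \<in> span S"
    then have "(x + s *\<^sub>R w) - x \<in> span S" using True by (rule span_diff)
    then have "s *\<^sub>R w \<in> span S" by simp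
    then have "inverse s *\<^sub>R (s *\<^sub>R w) \<in> span S" by (rule span_scale)
    then show False using w s by simp
  qed
  then show ?thesis using s by (intro exI[of _ "x + s *\<^sub>R w"]) simp
next
  case False
  then show ?thesis using assms by (intro exI[of _ x]) simp
qed

end

section \<open>Genericity of the duality map and openness of independence\<close>

context smooth_strictly_convex_space
begin

text \<open>If \<phi> x y = 0, then \<open>x\<close> has least norm on the line through
  \<open>x\<close> in direction \<open>y\<close>. Strict convexity allows only one such point when
  \<open>y\<close> is nonzero.\<close>

lemma phi_zero_on_line_unique:
  assumes "\<phi> x y = 0" "\<phi> (x + y) y = 0"
  shows "y = 0"
proof -
  let ?z = "x + y"
  have xz: "\<phi> x ?z = (norm x)\<^sup>2" and zx: "\<phi> ?z x = (norm ?z)\<^sup>2"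
    using assms linear_add[OF linear_phi, of x x y] linear_add[OF linear_phi, of ?z x y]
    by (simp_all add: phi_self)
  have 1: "norm x * norm x \<le> norm x * norm ?z" "norm ?z * norm ?z \<le> norm ?z * norm x"
    using phi_le[of x ?z] phi_le[of ?z x] by (simp_all add: xz zx power2_eq_square)
  show ?thesis
  proof (cases "x = 0 \<or> ?z = 0")
    case True
    then have "x = 0 \<and> ?z = 0" using 1 by (auto simp: mult_le_0_iff)
    then show ?thesis by (metis add_0)
  next
    case False
    then have N: "norm x > 0" "norm ?z = norm x"
      using 1 by (auto simp: mult_le_cancel_left_pos)
    have "norm x * (norm x + norm ?z) = \<phi> x (x + ?z)"
      by (simp only: linear_add[OF linear_phi, of x x ?z] xz phi_self N(2)) (simp add: power2_eq_square distrib_left)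
    also have "\<dots> \<le> norm x * norm (x + ?z)"
      using phi_le[of x "x + ?z"] by linarith
    finally have "\<not> norm (x + ?z) < norm x + norm ?z"
      using N(1) by (simp add: mult_le_cancel_left_pos)
    then obtain c where c: "?z = c *\<^sub>R x"
      using strictly_convex False unfolding strictly_convex_space_def by (metis add.commute)
    have "(norm x)\<^sup>2 = c * (norm x)\<^sup>2"
      using xz unfolding c by (simp add: linear_scale[OF linear_phi] phi_self)
    then have "c = 1" using N(1) by simp
    then show ?thesis using c by simp
  qed
qed

text \<open>A nonzero \<open>y\<close> killed by all of \<open>S\<close> is killed by its span, so
  any point with nonzero value at \<open>y\<close> escapes. If \<open>x\<close> itself does not,
  every nonzero shift of \<open>x\<close> along \<open>y\<close> does, by the preceding
  uniqueness.\<close>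

lemma phi_outside_span:
  assumes "finite S" "card S < d" "S \<subseteq> range \<phi>" "e > 0"
  shows "\<exists>x'. norm (x' - x) < e \<and> \<phi> x' \<notin> span S"
proof -
  have lin: "linear f" if f: "f \<in> S" for f
  proof -
    obtain z where "f = \<phi> z" using assms(3) f by auto
    then show ?thesis by (simp only: linear_phi)
  qed
  obtain y where y: "y \<noteq> 0" "\<forall>f\<in>S. f y = 0"
    using ex_common_zero[OF assms(1,2) lin] by blast
  have "subspace {f :: 'a \<Rightarrow> real. f y = 0}"
    by (auto simp: subspace_def scaleR_fun_def)
  then have ann: "f y = 0" if "f \<in> span S" for f
    using span_minimal[of S "{f. f y = 0}"] y(2) that by blast
  show ?thesis
  proof (cases "\<phi> x y = 0")
    case True
    define s where "s = e / (2 * norm y)"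
    have s: "s > 0" "norm (s *\<^sub>R y) < e"
      using y(1) assms(4) by (simp_all add: s_def)
    have "\<phi> (x + s *\<^sub>R y) y \<noteq> 0"
      using phi_zero_on_line_unique[of x "s *\<^sub>R y"] True s(1) y(1)
      by (auto simp: linear_scale[OF linear_phi])
    then have "\<phi> (x + s *\<^sub>R y) \<notin> span S" using ann by blast
    then show ?thesis using s by (intro exI[of _ "x + s *\<^sub>R y"]) simp
  next
    case False
    then have "\<phi> x \<notin> span S" using ann by blast
    then show ?thesis using assms(4) by (intro exI[of _ x]) simp
  qed
qed

lemma edge_functional_tendsto:
  assumes G: "simple_graph V E" and e: "e \<in> E" and q: "\<And>v. v \<in> V \<Longrightarrow> ((\<lambda>n. q n v) \<longlongrightarrow> p v) F"
  shows "((\<lambda>n. edge_functional (q n) e u) \<longlongrightarrow> edge_functional p e u) F"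
proof -
  obtain v w where vw: "e = {v, w}" "v \<noteq> w" "v \<in> V" "w \<in> V"
    by (rule simple_graph_edgeE[OF G e])
  show ?thesis
    unfolding vw(1) edge_functional_pair[OF vw(2)] by (intro tendsto_phi tendsto_intros q vw)
qed

lemma placement_eventually:
  assumes G: "simple_graph V E" and p: "placement V E p"
    and q: "\<And>n. q n \<in> configurations V" "\<And>v. v \<in> V \<Longrightarrow> ((\<lambda>n. q n v) \<longlongrightarrow> p v) F"
  shows "\<forall>\<^sub>F n in F. placement V E (q n)"
proof -
  let ?P = "{(v, w). {v, w} \<in> E}"
  have "?P \<subseteq> V \<times> V" using G by (auto simp: simple_graph_def)
  then have "finite ?P" using G finite_subset by (auto simp: simple_graph_def)
  moreover have "\<forall>\<^sub>F n in F. q n (fst z) \<noteq> q n (snd z)" if "z \<in> ?P" for z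
  proof -
    have "((\<lambda>n. q n (fst z) - q n (snd z)) \<longlongrightarrow> p (fst z) - p (snd z)) F"
      using that \<open>?P \<subseteq> V \<times> V\<close> by (intro tendsto_diff q) auto
    moreover have "p (fst z) - p (snd z) \<noteq> 0" using p that by (auto simp: placement_def)
    ultimately have "\<forall>\<^sub>F n in F. q n (fst z) - q n (snd z) \<noteq> 0"
      by (rule tendsto_imp_eventually_ne)
    then show ?thesis by eventually_elim simp
  qed
  ultimately have "\<forall>\<^sub>F n in F. \<forall>z\<in>?P. q n (fst z) \<noteq> q n (snd z)"
    by (intro eventually_ball_finite) auto
  then show ?thesis
    by eventually_elim (use q(1) in \<open>auto simp: placement_def\<close>)
qed

text \<open>Nonzero stresses of all \<open>q n\<close>, normalised to l1 size 1, would have a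
  subsequential limit, and it would be a stress of \<open>p\<close> of l1 size 1.\<close>

lemma stress_free_limit:
  assumes G: "simple_graph V E" and p: "stress_free E p"
    and q: "\<And>v. v \<in> V \<Longrightarrow> (\<lambda>n. q n v) \<longlonglongrightarrow> p v"
  shows "\<exists>n. stress_free E (q n)"
proof (rule ccontr)
  assume no: "\<not> ?thesis"
  have finE: "finite E" by (rule simple_graph_finite[OF G])
  have "\<exists>c. (\<forall>u. (\<Sum>e\<in>E. c e * edge_functional (q n) e u) = 0) \<and> (\<Sum>e\<in>E. \<bar>c e\<bar>) = 1" for n
  proof -
    obtain c e where c: "\<And>u. (\<Sum>e\<in>E. c e * edge_functional (q n) e u) = 0" and e: "e \<in> E" "c e \<noteq> 0"
      using no unfolding stress_free_def by blast
    define s where "s = (\<Sum>e\<in>E. \<bar>c e\<bar>)"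
    have "s > 0" unfolding s_def by (rule sum_pos2[OF finE e(1)]) (use e(2) in auto)
    have "(\<Sum>e\<in>E. c e / s * edge_functional (q n) e u) = 0" for u
      using c[of u] by (simp flip: sum_divide_distrib)
    moreover have "(\<Sum>e\<in>E. \<bar>c e / s\<bar>) = 1"
      using \<open>s > 0\<close> by (simp add: abs_divide s_def[symmetric] flip: sum_divide_distrib)
    ultimately show ?thesis by (intro exI[of _ "\<lambda>e. c e / s"]) simp
  qed
  then obtain c where c: "\<And>n u. (\<Sum>e\<in>E. c n e * edge_functional (q n) e u) = 0"
      "\<And>n. (\<Sum>e\<in>E. \<bar>c n e\<bar>) = 1"
    by metis
  have "\<bar>c n e\<bar> \<le> 1" if "e \<in> E" for n e
    using member_le_sum[OF that, of "\<lambda>e. \<bar>c n e\<bar>"] finE c(2)[of n] by simp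
  note bd = this
  obtain l r where r: "strict_mono (r :: nat \<Rightarrow> nat)" and l: "\<And>e. e \<in> E \<Longrightarrow> (\<lambda>n. c (r n) e) \<longlonglongrightarrow> l e"
    by (rule bolzano_weierstrass_finite_family[of E c 1]) (use finE bd in auto)
  have qr: "(\<lambda>n. q (r n) v) \<longlonglongrightarrow> p v" if "v \<in> V" for v
    using LIMSEQ_subseq_LIMSEQ[OF q[OF that] r] by (simp add: o_def)
  have "(\<Sum>e\<in>E. l e * edge_functional p e u) = 0" for u
  proof -
    have "(\<lambda>n. \<Sum>e\<in>E. c (r n) e * edge_functional (q (r n)) e u) \<longlonglongrightarrow> (\<Sum>e\<in>E. l e * edge_functional p e u)"
      by (intro tendsto_sum tendsto_mult l edge_functional_tendsto[OF G] qr)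
    then show ?thesis by (simp add: c(1) LIMSEQ_const_iff)
  qed
  then have "\<forall>e\<in>E. l e = 0" using p unfolding stress_free_def by blast
  moreover have "(\<lambda>n. \<Sum>e\<in>E. \<bar>c (r n) e\<bar>) \<longlonglongrightarrow> (\<Sum>e\<in>E. \<bar>l e\<bar>)"
    by (intro tendsto_intros l)
  ultimately show False by (simp add: c(2) LIMSEQ_const_iff)
qed

lemma independent_framework_open:
  fixes p :: "'v \<Rightarrow> 'a"
  assumes G: "simple_graph V E" and p: "independent_framework b V E p"
  obtains e where "e > 0"
    and "\<And>q. q \<in> configurations V \<Longrightarrow> (\<And>v. v \<in> V \<Longrightarrow> norm (q v - p v) < e) \<Longrightarrow> independent_framework b V E q"
proof -
  have "\<exists>e>0. \<forall>q. q \<in> configurations V \<longrightarrow> (\<forall>v\<in>V. norm (q v - p v) < e) \<longrightarrow> independent_framework b V E q"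
  proof (rule ccontr)
    assume no: "\<not> ?thesis"
    have "\<exists>q. q \<in> configurations V \<and> (\<forall>v\<in>V. norm (q v - p v) < inverse (real (Suc n))) \<and>
        \<not> independent_framework b V E q" for n
    proof -
      have "inverse (real (Suc n)) > 0" by simp
      then show ?thesis using no by blast
    qed
    then obtain q where q: "\<And>n. q n \<in> configurations V"
      "\<And>n v. v \<in> V \<Longrightarrow> norm (q n v - p v) < inverse (real (Suc n))"
      "\<And>n. \<not> independent_framework b V E (q n)"
      by metis
    have lim: "(\<lambda>n. q n v) \<longlonglongrightarrow> p v" if "v \<in> V" for v
    proof (rule LIM_zero_cancel, rule Lim_null_comparison[OF _ LIMSEQ_inverse_real_of_nat])
      show "\<forall>\<^sub>F n in sequentially. norm (q n v - p v) \<le> inverse (real (Suc n))"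
        using q(2)[OF that] by (intro always_eventually allI less_imp_le)
    qed
    have "\<forall>\<^sub>F n in sequentially. placement V E (q n)"
      using p by (intro placement_eventually[OF G _ q(1) lim]) (simp add: independent_framework_iff[OF G])
    then obtain N where N: "\<And>n. n \<ge> N \<Longrightarrow> placement V E (q n)"
      by (auto simp: eventually_sequentially)
    have "(\<lambda>n. q (n + N) v) \<longlonglongrightarrow> p v" if "v \<in> V" for v
      by (rule LIMSEQ_ignore_initial_segment[OF lim[OF that]])
    then obtain n where "stress_free E (q (n + N))"
      using stress_free_limit[OF G, of p "\<lambda>n. q (n + N)"] p
      by (auto simp: independent_framework_iff[OF G])
    then show False
      using q(3)[of "n + N"] N[of "n + N"] by (simp add: independent_framework_iff[OF G])
  qed
  then show ?thesis using that by blast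
qed

text \<open>The point of \<open>v (d+1)\<close> serves as origin. The \<open>d\<close> differences
  to it are perturbed into a basis, by less than the radius in which independence persists.\<close>

lemma ex_affinely_spanning_independent:
  fixes p :: "'v \<Rightarrow> 'a"
  assumes G: "simple_graph V E" and p: "independent_framework b V E p"
    and v: "inj_on v {1..d+1}" "v ` {1..d+1} \<subseteq> V"
  shows "\<exists>q. independent_framework b V E q \<and> affinely_spanning V q"
proof -
  obtain e where e: "e > 0"
    and near: "\<And>q. q \<in> configurations V \<Longrightarrow> (\<And>v. v \<in> V \<Longrightarrow> norm (q v - p v) < e) \<Longrightarrow>
      independent_framework b V E q"
    using independent_framework_open[OF G p] by blast
  let ?y = "p (v (d+1))"
  obtain x' where x'': "\<forall>i\<in>{1..d}. norm (x' i - (p (v i) - ?y)) < e \<and> x' i \<notin> span (x' ` {1..<i})"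
    using perturbation_outside_spans[of "\<lambda>x. x" e d "\<lambda>i. p (v i) - ?y"] vector_outside_span e by auto
  then have x': "norm (x' i - (p (v i) - ?y)) < e" "x' i \<notin> span (x' ` {1..<i})" if "i \<in> {1..d}" for i
    using that by blast+
  define q where "q w = (if w \<in> v ` {1..d} then ?y + x' (the_inv_into {1..d+1} v w) else p w)" for w
  have qv: "q (v i) = ?y + x' i" if "i \<in> {1..d}" for i
    using that the_inv_into_f_f[OF v(1), of i] by (simp add: q_def)
  have "v (d+1) \<notin> v ` {1..d}"
  proof
    assume "v (d+1) \<in> v ` {1..d}"
    then obtain i where "i \<in> {1..d}" "v (d+1) = v i" by blast
    then show False using inj_onD[OF v(1), of "d+1" i] by auto
  qed
  then have qy: "q (v (d+1)) = ?y" by (simp add: q_def)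
  have "independent_framework b V E q"
  proof (rule near)
    have "p \<in> configurations V" using p by (simp add: independent_framework_iff[OF G] placement_def)
    moreover have "v ` {1..d} \<subseteq> V" using v(2) by auto
    ultimately show "q \<in> configurations V" unfolding configurations_def q_def by auto
    show "norm (q w - p w) < e" for w
    proof (cases "w \<in> v ` {1..d}")
      case True
      then obtain i where i: "i \<in> {1..d}" "w = v i" by blast
      have "q w - p w = x' i - (p (v i) - ?y)" by (simp add: i(2) qv[OF i(1)])
      then show ?thesis using x'(1)[OF i(1)] by simp
    qed (use e in \<open>simp add: q_def\<close>)
  qed
  moreover have "affinely_spanning V q"
    unfolding affinely_spanning_def
  proof (intro allI impI)
    fix Z :: "'a \<Rightarrow> 'a" and a assume Z: "linear Z" and Za: "\<forall>v\<in>V. Z (q v) + a = 0"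
    have ind: "inj_on x' {1..d}" "independent (x' ` {1..d})"
      using independent_sequence[of d x'] x'(2) by auto
    have sp: "span (x' ` {1..d}) = UNIV"
      by (rule span_eq_UNIV_if_card[OF ind(2)]) (use card_image[OF ind(1)] in simp)
    have "Z (x' i) = 0" if "i \<in> {1..d}" for i
    proof -
      have "v i \<in> V" "v (d+1) \<in> V"
        using that by (intro subsetD[OF v(2)] imageI; simp)+
      then have "Z (q (v i)) + a = 0" "Z (q (v (d+1))) + a = 0"
        using Za by blast+
      then have "Z ?y + Z (x' i) + a = 0" "Z ?y + a = 0"
        unfolding qv[OF that] qy linear_add[OF Z] .
      then show ?thesis by (metis add.right_neutral add.commute add.left_commute add_left_cancel)
    qed
    then have "Z x = 0" for x
      by (intro linear_eq_0_on_span[OF Z, of "x' ` {1..d}" x]) (use sp in auto)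
    then show "Z = (\<lambda>_. 0)" by blast
  qed
  ultimately show ?thesis by blast
qed

end

section \<open>One-extensions\<close>

context smooth_strictly_convex_space
begin

lemma one_extension_simple_graph:
  assumes G: "simple_graph V E" and v: "inj_on v {1..d+1}" "v ` {1..d+1} \<subseteq> V" and v0: "v0 \<notin> V"
  shows "simple_graph (insert v0 V) ((E - {{v d, v (d+1)}}) \<union> (\<lambda>i. {v0, v i}) ` {1..d+1})"
proof -
  have "card {v0, v i} = 2" if "i \<in> {1..d+1}" for i
    using that v(2) v0 by (subst card_2_iff) blast
  note card2 = this
  have "e \<subseteq> insert v0 V \<and> card e = 2"
    if e: "e \<in> (E - {{v d, v (d+1)}}) \<union> (\<lambda>i. {v0, v i}) ` {1..d+1}" for e
    using e
  proof
    assume "e \<in> E - {{v d, v (d+1)}}"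
    then show ?thesis using G by (auto simp: simple_graph_def)
  next
    assume "e \<in> (\<lambda>i. {v0, v i}) ` {1..d+1}"
    then obtain i where i: "i \<in> {1..d+1}" "e = {v0, v i}" by blast
    then have "v i \<in> V" using v(2) by blast
    then show ?thesis using i(2) card2[OF i(1)] by simp
  qed
  then show ?thesis
    using G by (simp add: simple_graph_def)
qed

lemma one_extension_card:
  assumes G: "simple_graph V E" and v: "inj_on v {1..d+1}" "v ` {1..d+1} \<subseteq> V" "{v d, v (d+1)} \<in> E"
    and v0: "v0 \<notin> V"
  shows "card ((E - {{v d, v (d+1)}}) \<union> (\<lambda>i. {v0, v i}) ` {1..d+1}) = card E + d"
    and "inj_on (\<lambda>i. {v0, v i}) {1..d+1}"
    and "E \<inter> (\<lambda>i. {v0, v i}) ` {1..d+1} = {}"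
proof -
  have finE: "finite E" by (rule simple_graph_finite[OF G])
  show inj: "inj_on (\<lambda>i. {v0, v i}) {1..d+1}"
    using inj_onD[OF v(1)] v(2) v0 by (auto simp: inj_on_def doubleton_eq_iff)
  show disj: "E \<inter> (\<lambda>i. {v0, v i}) ` {1..d+1} = {}"
    using G v0 unfolding simple_graph_def by blast
  have "card E > 0" using finE v(3) by (auto simp: card_gt_0_iff)
  have "card ((E - {{v d, v (d+1)}}) \<union> (\<lambda>i. {v0, v i}) ` {1..d+1}) =
      card (E - {{v d, v (d+1)}}) + card ((\<lambda>i. {v0, v i}) ` {1..d+1})"
    using finE disj by (intro card_Un_disjoint) auto
  then show "card ((E - {{v d, v (d+1)}}) \<union> (\<lambda>i. {v0, v i}) ` {1..d+1}) = card E + d"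
    using card_image[OF inj] v(3) \<open>card E > 0\<close> by (simp add: card_Diff_singleton)
qed

text \<open>The new vertex is the midpoint of the deleted edge, so that the functionals of its last two
  edges are multiples of the functional \<open>\<psi>\<close> of the deleted edge. Equilibrium at the new vertex
  then forces those two coefficients to agree and the others to vanish.\<close>

lemma stress_free_one_extension:
  fixes q :: "'v \<Rightarrow> 'a"
  assumes G: "simple_graph V E" and q: "stress_free E q"
    and v: "inj_on v {1..d+1}" "v ` {1..d+1} \<subseteq> V" "{v d, v (d+1)} \<in> E" and v0: "v0 \<notin> V"
    and d: "d \<ge> 1"
    and qd: "q (v d) - q (v (d+1)) = x d" and m: "m - q (v d) = - ((1/2) *\<^sub>R x d)"
    and x: "\<And>i. i \<in> {1..<d} \<Longrightarrow> m - q (v i) = x i"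
    and ind: "\<And>i. i \<in> {1..d} \<Longrightarrow> \<phi> (x i) \<notin> span ((\<lambda>i. \<phi> (x i)) ` {1..<i})"
  shows "stress_free ((E - {{v d, v (d+1)}}) \<union> (\<lambda>i. {v0, v i}) ` {1..d+1}) (q(v0 := m))"
  unfolding stress_free_def
proof (intro allI impI)
  fix c
  let ?e0 = "{v d, v (d+1)}" and ?E' = "(E - {{v d, v (d+1)}}) \<union> (\<lambda>i. {v0, v i}) ` {1..d+1}"
  let ?q' = "q(v0 := m)" and ?\<psi> = "\<phi> (x d)"
  assume "\<forall>u. (\<Sum>e\<in>?E'. c e * edge_functional ?q' e u) = 0"
  then have c: "(\<Sum>e\<in>?E'. c e * edge_functional ?q' e u) = 0" for u by blast
  have finE: "finite E" by (rule simple_graph_finite[OF G])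
  define a where "a i = c {v0, v i}" for i
  have vV: "v i \<in> V" if "i \<in> {1..d+1}" for i using v(2) that by blast
  have old: "edge_functional ?q' e u = edge_functional q e u" if e: "e \<in> E" for e u
  proof -
    obtain w z where wz: "e = {w, z}" "w \<noteq> z" "w \<in> V" "z \<in> V" by (rule simple_graph_edgeE[OF G e])
    then have "w \<noteq> v0" "z \<noteq> v0" using v0 by auto
    then show ?thesis unfolding wz(1) edge_functional_pair[OF wz(2)] by simp
  qed
  have new: "edge_functional ?q' {v0, v i} u = \<phi> (m - q (v i)) (u v0 - u (v i))" if i: "i \<in> {1..d+1}" for i u
  proof -
    have ne: "v0 \<noteq> v i" using v0 vV[OF i] by blast
    then show ?thesis unfolding edge_functional_pair[OF ne] by simp
  qed
  have m': "m - q (v (d+1)) = (1/2) *\<^sub>R x d"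
  proof -
    have "m - q (v (d+1)) = (m - q (v d)) + (q (v d) - q (v (d+1)))" by simp
    also have "\<dots> = x d - (1/2) *\<^sub>R x d" unfolding m qd by simp
    also have "\<dots> = (1/2) *\<^sub>R x d" using scaleR_left_diff_distrib[of 1 "1/2" "x d"] by simp
    finally show ?thesis .
  qed
  have split: "{1..d+1} = insert (d+1) (insert d {1..<d})" using d by auto
  have balance: "(\<Sum>e\<in>E - {?e0}. c e * edge_functional q e u) +
      ((\<Sum>i\<in>{1..<d}. a i * \<phi> (x i) (u v0 - u (v i))) +
       (a (d+1) / 2 * ?\<psi> (u v0 - u (v (d+1))) - a d / 2 * ?\<psi> (u v0 - u (v d)))) = 0" for u
  proof -
    have "(\<Sum>e\<in>?E'. c e * edge_functional ?q' e u) =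
        (\<Sum>e\<in>E - {?e0}. c e * edge_functional ?q' e u) +
        (\<Sum>e\<in>(\<lambda>i. {v0, v i}) ` {1..d+1}. c e * edge_functional ?q' e u)"
      using finE one_extension_card(3)[OF G v v0] by (intro sum.union_disjoint) auto
    also have "(\<Sum>e\<in>E - {?e0}. c e * edge_functional ?q' e u) = (\<Sum>e\<in>E - {?e0}. c e * edge_functional q e u)"
      by (rule sum.cong) (simp_all add: old)
    also have "(\<Sum>e\<in>(\<lambda>i. {v0, v i}) ` {1..d+1}. c e * edge_functional ?q' e u) =
        (\<Sum>i\<in>{1..d+1}. a i * \<phi> (m - q (v i)) (u v0 - u (v i)))"
      unfolding sum.reindex[OF one_extension_card(2)[OF G v v0]]
      by (rule sum.cong) (simp_all only: o_def new a_def)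
    also have "\<dots> = (\<Sum>i\<in>{1..<d}. a i * \<phi> (m - q (v i)) (u v0 - u (v i))) +
        (a (d+1) * \<phi> (m - q (v (d+1))) (u v0 - u (v (d+1))) + a d * \<phi> (m - q (v d)) (u v0 - u (v d)))"
      unfolding split by simp
    also have "(\<Sum>i\<in>{1..<d}. a i * \<phi> (m - q (v i)) (u v0 - u (v i))) =
        (\<Sum>i\<in>{1..<d}. a i * \<phi> (x i) (u v0 - u (v i)))"
      by (rule sum.cong) (simp_all only: x)
    finally show ?thesis
      unfolding c m m' by (simp add: phi_scale phi_minus)
  qed
  \<comment> \<open>The net coefficient of \<phi> (x i) at the new vertex. The two halves of the
    deleted edge both contribute multiples of the functional of \<open>x d\<close>, with opposite
    signs and factor 1/2.\<close>
  define a' where "a' i = (if i = d then (a (d+1) - a d) / 2 else a i)" for i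
  have fam: "inj_on (\<lambda>i. \<phi> (x i)) {1..d} \<and> independent ((\<lambda>i. \<phi> (x i)) ` {1..d})"
    by (rule independent_sequence) (rule ind)
  have "(\<Sum>i\<in>{1..d}. a' i *\<^sub>R \<phi> (x i)) = 0"
  proof
    fix z :: 'a
    \<comment> \<open>Moving only the new vertex leaves the old edges silent and isolates the
      equilibrium there.\<close>
    let ?u = "\<lambda>w. if w = v0 then z else 0"
    have "edge_functional q e ?u = 0" if e: "e \<in> E" for e
    proof -
      obtain w w' where w: "e = {w, w'}" "w \<noteq> w'" "w \<in> V" "w' \<in> V" by (rule simple_graph_edgeE[OF G e])
      then have "w \<noteq> v0" "w' \<noteq> v0" using v0 by auto
      then show ?thesis unfolding w(1) edge_functional_pair[OF w(2)] by (simp add: linear_0[OF linear_phi])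
    qed
    then have z0: "(\<Sum>e\<in>E - {?e0}. c e * edge_functional q e ?u) = 0"
      by (intro sum.neutral) simp
    have uv: "?u v0 - ?u (v i) = z" if "i \<in> {1..d+1}" for i
      using v0 vV[OF that] by auto
    have s1: "(\<Sum>i\<in>{1..<d}. a i * \<phi> (x i) (?u v0 - ?u (v i))) = (\<Sum>i\<in>{1..<d}. a' i * \<phi> (x i) z)"
      by (rule sum.cong) (use uv in \<open>auto simp: a'_def\<close>)
    have "d \<in> {1..d+1}" "d + 1 \<in> {1..d+1}" using d by auto
    then have "(\<Sum>i\<in>{1..<d}. a' i * \<phi> (x i) z) + (a (d+1) / 2 * ?\<psi> z - a d / 2 * ?\<psi> z) = 0"
      using balance[of ?u] unfolding z0 s1 by (simp only: uv add_0)
    moreover have "{1..d} = insert d {1..<d}" using d by auto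
    ultimately show "(\<Sum>i\<in>{1..d}. a' i *\<^sub>R \<phi> (x i)) z = 0 z"
      by (simp add: sum_fun_apply scaleR_fun_def a'_def diff_divide_distrib left_diff_distrib algebra_simps)
  qed
  then have a': "\<And>i. i \<in> {1..d} \<Longrightarrow> a' i = 0"
    using fam independent_family_iff[of "{1..d}" "\<lambda>i. \<phi> (x i)"] by blast
  have a0: "a i = 0" if "i \<in> {1..<d}" for i
    using a'[of i] that by (simp add: a'_def)
  have ad: "a (d+1) = a d"
    using a'[of d] d by (simp add: a'_def)
  \<comment> \<open>Since the coefficients on the two halves agree, the terms in \<open>u v0\<close>
    cancel and together they act as the deleted edge with coefficient \<open>a d / 2\<close>. This
    turns the stress of the extended graph into one of \<open>G\<close>.\<close>
  define c' where "c' e = (if e = ?e0 then a d / 2 else c e)" for e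
  have "(\<Sum>e\<in>E. c' e * edge_functional q e u) = 0" for u
  proof -
    have "v d \<noteq> v (d+1)" using inj_onD[OF v(1), of d "d+1"] d by auto
    then have e0: "edge_functional q ?e0 u = ?\<psi> (u (v d) - u (v (d+1)))"
      by (simp only: edge_functional_pair qd not_False_eq_True)
    have "(\<Sum>e\<in>E. c' e * edge_functional q e u) =
        c' ?e0 * edge_functional q ?e0 u + (\<Sum>e\<in>E - {?e0}. c' e * edge_functional q e u)"
      by (rule sum.remove[OF finE v(3)])
    also have "(\<Sum>e\<in>E - {?e0}. c' e * edge_functional q e u) = (\<Sum>e\<in>E - {?e0}. c e * edge_functional q e u)"
      by (rule sum.cong) (auto simp: c'_def)
    also have "c' ?e0 * edge_functional q ?e0 u = a d / 2 * ?\<psi> (u (v d) - u (v (d+1)))"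
      unfolding e0 by (simp add: c'_def)
    also have "\<dots> = a (d+1) / 2 * ?\<psi> (u v0 - u (v (d+1))) - a d / 2 * ?\<psi> (u v0 - u (v d))"
      unfolding ad by (simp add: linear_diff[OF linear_phi] algebra_simps)
    finally show ?thesis
      using balance[of u] a0 by simp
  qed
  then have c'0: "\<forall>e\<in>E. c' e = 0" using q unfolding stress_free_def by blast
  have "a d = 0" using bspec[OF c'0 v(3)] by (simp add: c'_def)
  then have a_all: "a i = 0" if "i \<in> {1..d+1}" for i
    using that a0 ad unfolding split by auto
  show "\<forall>e\<in>?E'. c e = 0"
  proof
    fix e assume "e \<in> ?E'"
    then show "c e = 0"
    proof
      assume e: "e \<in> E - {?e0}"
      then have "e \<noteq> ?e0" by blast
      then have "c' e = c e" unfolding c'_def by (rule if_not_P)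
      then show ?thesis using c'0 e by simp
    next
      assume "e \<in> (\<lambda>i. {v0, v i}) ` {1..d+1}"
      then show ?thesis using a_all unfolding a_def by blast
    qed
  qed
qed

text \<open>What is perturbed are difference vectors, not positions. The point of
  \<open>v (d+1)\<close> stays, \<open>x' d\<close> is the new edge vector and fixes both
  \<open>v d\<close> and the midpoint \<open>m\<close>, and the remaining \<open>v i\<close> are
  placed at \<open>m - x' i\<close>.\<close>

lemma independent_graph_one_extension:
  fixes V :: "'v set"
  assumes G: "simple_graph V E" and E: "independent_graph b V E"
    and v: "inj_on v {1..d+1}" "v ` {1..d+1} \<subseteq> V" "{v d, v (d+1)} \<in> E" and v0: "v0 \<notin> V"
    and d: "d \<ge> 1"
  shows "independent_graph b (insert v0 V) ((E - {{v d, v (d+1)}}) \<union> (\<lambda>i. {v0, v i}) ` {1..d+1})"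
proof -
  let ?E' = "(E - {{v d, v (d+1)}}) \<union> (\<lambda>i. {v0, v i}) ` {1..d+1}"
  obtain p :: "'v \<Rightarrow> 'a" where p: "independent_framework b V E p"
    using E by (auto simp: independent_graph_def)
  obtain e where e: "e > 0"
    and near: "\<And>q. q \<in> configurations V \<Longrightarrow> (\<And>v. v \<in> V \<Longrightarrow> norm (q v - p v) < e) \<Longrightarrow>
      independent_framework b V E q"
    using independent_framework_open[OF G p] by blast
  define y where "y = p (v (d+1))"
  define p0 where "p0 = y + (1/2) *\<^sub>R (p (v d) - y)"
  define x where "x i = (if i = d then p (v d) - y else p0 - p (v i))" for i
  \<comment> \<open>Half of \<open>e\<close>, because the position of \<open>v i\<close> for
    \<open>i < d\<close> inherits both the error of \<open>x' i\<close> and that of the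
    midpoint.\<close>
  obtain x' where "\<forall>i\<in>{1..d}. norm (x' i - x i) < e / 2 \<and>
      \<phi> (x' i) \<notin> span ((\<lambda>i. \<phi> (x' i)) ` {1..<i})"
    using perturbation_outside_spans[of \<phi> "e/2" d x] phi_outside_span e by auto
  then have x': "norm (x' i - x i) < e / 2" "\<phi> (x' i) \<notin> span ((\<lambda>i. \<phi> (x' i)) ` {1..<i})"
    if "i \<in> {1..d}" for i
    using that by blast+
  \<comment> \<open>The functional of 0 is 0 and lies in every span. Nonzero differences keep the
    new vertex apart from its neighbours.\<close>
  have x'_nz: "x' i \<noteq> 0" if i: "i \<in> {1..d}" for i
  proof
    assume "x' i = 0"
    then have "\<phi> (x' i) = 0" by (auto simp: phi_0)
    then show False using x'(2)[OF i] span_zero by metis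
  qed
  define m where "m = y + (1/2) *\<^sub>R x' d"
  define q where "q w = (if w \<in> v ` {1..d} then
      let i = the_inv_into {1..d+1} v w in (if i = d then y + x' d else m - x' i) else p w)" for w
  have qv: "q (v i) = (if i = d then y + x' d else m - x' i)" if "i \<in> {1..d}" for i
    using that the_inv_into_f_f[OF v(1), of i] by (simp add: q_def)
  have dd: "d \<in> {1..d}" using d by simp
  have "v (d+1) \<notin> v ` {1..d}"
  proof
    assume "v (d+1) \<in> v ` {1..d}"
    then obtain i where "i \<in> {1..d}" "v (d+1) = v i" by blast
    then show False using inj_onD[OF v(1), of "d+1" i] by auto
  qed
  then have qy: "q (v (d+1)) = y" by (simp add: q_def y_def)
  have half: "norm ((1/2) *\<^sub>R (x' d - x d)) < e / 2"
    using x'(1)[OF dd] norm_ge_zero[of "x' d - x d"] e by simp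
  have qV: "independent_framework b V E q"
  proof (rule near)
    have "p \<in> configurations V" using p by (simp add: independent_framework_iff[OF G] placement_def)
    moreover have "v ` {1..d} \<subseteq> V" using v(2) by auto
    ultimately show "q \<in> configurations V" unfolding configurations_def q_def by auto
    show "norm (q w - p w) < e" for w
    proof (cases "w \<in> v ` {1..d}")
      case True
      then obtain i where i: "i \<in> {1..d}" "w = v i" by blast
      show ?thesis
      proof (cases "i = d")
        case True
        have "q w - p w = x' d - x d" using True by (simp add: i(2) qv[OF dd] x_def)
        then show ?thesis using x'(1)[OF dd] e by simp
      next
        case False
        have "q w - p w = (1/2) *\<^sub>R (x' d - x d) - (x' i - x i)"
          using False by (simp add: i(2) qv[OF i(1)] x_def m_def p0_def scaleR_diff_right)
        also have "norm \<dots> \<le> norm ((1/2) *\<^sub>R (x' d - x d)) + norm (x' i - x i)"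
          by (rule norm_triangle_ineq4)
        also have "\<dots> < e / 2 + e / 2" by (rule add_strict_mono[OF half x'(1)[OF i(1)]])
        finally show ?thesis by simp
      qed
    qed (use e in \<open>simp add: q_def\<close>)
  qed
  have qd: "q (v d) - q (v (d+1)) = x' d" unfolding qv[OF dd] qy by simp
  have md: "m - q (v d) = - ((1/2) *\<^sub>R x' d)"
  proof -
    have "m - q (v d) = (1/2) *\<^sub>R x' d - 1 *\<^sub>R x' d" by (simp add: m_def qv[OF dd])
    also have "\<dots> = (1/2 - 1) *\<^sub>R x' d" by (rule scaleR_left_diff_distrib[symmetric])
    finally show ?thesis by simp
  qed
  have mi: "m - q (v i) = x' i" if "i \<in> {1..<d}" for i
    using that by (simp add: qv)
  have stress: "stress_free ?E' (q(v0 := m))"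
    by (rule stress_free_one_extension[of V E q v v0 x' m])
      (use G qV v v0 d qd md mi x'(2) in \<open>auto simp: independent_framework_iff[OF G]\<close>)
  have new: "m \<noteq> q (v i)" if i: "i \<in> {1..d+1}" for i
  proof -
    consider "i \<in> {1..<d}" | "i = d" | "i = d + 1" using i by fastforce
    then show ?thesis
    proof cases
      case 1
      then show ?thesis using mi[OF 1] x'_nz[of i] by auto
    next
      case 2
      then show ?thesis using md x'_nz[OF dd] by auto
    next
      case 3
      have "m - q (v i) = (1/2) *\<^sub>R x' d" unfolding 3 qy by (simp add: m_def)
      then show ?thesis using x'_nz[OF dd] by auto
    qed
  qed
  have pq: "placement V E q" using qV by (simp add: independent_framework_iff[OF G])
  have "placement (insert v0 V) ?E' (q(v0 := m))"
    unfolding placement_def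
  proof (intro conjI allI impI)
    show "q(v0 := m) \<in> configurations (insert v0 V)"
      using pq by (auto simp: placement_def configurations_def)
    fix w w' assume "{w, w'} \<in> ?E'"
    then show "(q(v0 := m)) w \<noteq> (q(v0 := m)) w'"
    proof
      assume e: "{w, w'} \<in> E - {{v d, v (d+1)}}"
      then have "w \<in> V" "w' \<in> V" using G by (auto simp: simple_graph_def)
      then have "w \<noteq> v0" "w' \<noteq> v0" using v0 by auto
      then show ?thesis using pq e by (simp add: placement_def)
    next
      assume "{w, w'} \<in> (\<lambda>i. {v0, v i}) ` {1..d+1}"
      then obtain i where i: "i \<in> {1..d+1}" "{w, w'} = {v0, v i}" by blast
      have "v i \<noteq> v0" using i(1) v(2) v0 by blast
      then show ?thesis using i(2) new[OF i(1)] by (auto simp: doubleton_eq_iff)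
    qed
  qed
  then have "independent_framework b (insert v0 V) ?E' (q(v0 := m))"
    using stress independent_framework_iff[OF one_extension_simple_graph[OF G v(1,2) v0]] by blast
  then show ?thesis by (auto simp: independent_graph_def)
qed

text \<open>The \<open>d + 1\<close> chosen vertices belong to both graphs, so each has an
  independent affinely spanning placement and both counts use the same space of motions.\<close>

lemma rigid_graph_one_extension_iff:
  fixes V :: "'v set"
  assumes G: "simple_graph V E" and v: "inj_on v {1..d+1}" "v ` {1..d+1} \<subseteq> V" "{v d, v (d+1)} \<in> E"
    and v0: "v0 \<notin> V"
    and ind: "independent_graph b V E"
      "independent_graph b (insert v0 V) ((E - {{v d, v (d+1)}}) \<union> (\<lambda>i. {v0, v i}) ` {1..d+1})"
  shows "rigid_graph b V E \<longleftrightarrow>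
    rigid_graph b (insert v0 V) ((E - {{v d, v (d+1)}}) \<union> (\<lambda>i. {v0, v i}) ` {1..d+1})"
proof -
  let ?E' = "(E - {{v d, v (d+1)}}) \<union> (\<lambda>i. {v0, v i}) ` {1..d+1}"
  have ne: "V \<noteq> {}" and finV: "finite V" using v(2) G by (auto simp: simple_graph_def)
  have G': "simple_graph (insert v0 V) ?E'" by (rule one_extension_simple_graph[OF G v(1,2) v0])
  have v': "v ` {1..d+1} \<subseteq> insert v0 V" using v(2) by blast
  obtain p where p: "independent_framework b V E p" using ind(1) by (auto simp: independent_graph_def)
  obtain p' where p': "independent_framework b (insert v0 V) ?E' p'"
    using ind(2) by (auto simp: independent_graph_def)
  obtain q where q: "independent_framework b V E q" "affinely_spanning V q"
    using ex_affinely_spanning_independent[OF G p v(1,2)] by blast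
  obtain q' where q': "independent_framework b (insert v0 V) ?E' q'" "affinely_spanning (insert v0 V) q'"
    using ex_affinely_spanning_independent[OF G' p' v(1) v'] by blast
  have "rigid_graph b V E \<longleftrightarrow> card E + dim infinitesimal_motions = d * card V"
    by (rule rigid_graph_iff_card[OF G ne q])
  moreover have "rigid_graph b (insert v0 V) ?E' \<longleftrightarrow>
      card ?E' + dim infinitesimal_motions = d * card (insert v0 V)"
    by (rule rigid_graph_iff_card[OF G' _ q']) simp
  moreover have "card ?E' = card E + d" by (rule one_extension_card(1)[OF G v v0])
  moreover have "card (insert v0 V) = card V + 1" using finV v0 by simp
  ultimately show ?thesis by simp
qed

end

text \<open>Placements separate the ends of each edge, impossible in a single point. This disposes
  of \<open>d = 0\<close>, where an extension refers to \<open>v 0\<close>, outside the index range,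
  but still supplies an edge of \<open>E\<close>.\<close>

lemma no_independent_graph_in_dimension_0:
  fixes b :: "nat \<Rightarrow> 'a::real_normed_vector" and V :: "'v set"
  assumes "basis_family b" "dim (UNIV :: 'a set) = 0" "simple_graph V E" "E \<noteq> {}"
  shows "\<not> independent_graph b V E"
proof
  assume "independent_graph b V E"
  then obtain p :: "'v \<Rightarrow> 'a" where p: "placement V E p"
    by (auto simp: independent_graph_def independent_framework_def well_positioned_def)
  obtain e where e: "e \<in> E" using assms(4) by blast
  then have "card e = 2" using assms(3) by (simp add: simple_graph_def)
  then obtain v w where vw: "e = {v, w}" by (auto simp: card_2_iff)
  have "(UNIV :: 'a set) = {0}"
    using assms(1,2) by (simp add: basis_family_def)
  then have "p v = p w" by (metis UNIV_I singletonD)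
  then show False using p e vw by (auto simp: placement_def)
qed

theorem proposition4p5:
  fixes b :: "nat \<Rightarrow> 'a::real_normed_vector"
    and V V' :: "'v set"
    and E E' :: "'v set set"
  assumes "finite_dimensional TYPE('a)"
    and "smooth_space TYPE('a)"
    and "strictly_convex_space TYPE('a)"
    and "basis_family b"
    and "simple_graph V E"
    and "one_extension (dim (UNIV :: 'a set)) V E V' E'"
  shows "(independent_graph b V E \<longrightarrow> independent_graph b V' E') \<and>
    (independent_graph b V E \<and> independent_graph b V' E' \<longrightarrow>
      (rigid_graph b V E \<longleftrightarrow> rigid_graph b V' E'))"
proof -
  interpret smooth_strictly_convex_space b "dim (UNIV :: 'a set)"
    by unfold_locales (use assms in auto)
  let ?d = "dim (UNIV :: 'a set)"
  obtain v :: "nat \<Rightarrow> 'v" and v0 where v: "inj_on v {1..?d+1}" "v ` {1..?d+1} \<subseteq> V" "{v ?d, v (?d+1)} \<in> E"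
    and v0: "v0 \<notin> V" and V': "V' = insert v0 V"
    and E': "E' = (E - {{v ?d, v (?d+1)}}) \<union> (\<lambda>i. {v0, v i}) ` {1..?d+1}"
    using assms(6) unfolding one_extension_def by blast
  show ?thesis
  proof (cases "?d = 0")
    case True
    then show ?thesis
      using no_independent_graph_in_dimension_0[OF assms(4) True assms(5)] v(3) by blast
  next
    case False
    then have "?d \<ge> 1" by simp
    then show ?thesis
      unfolding V' E'
      using independent_graph_one_extension[OF assms(5) _ v v0] rigid_graph_one_extension_iff[OF assms(5) v v0]
      by blast
  qed
qed

end
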